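(* Let $q\in\mathcal V\setminus\overline{\mathcal U}$, write $(\alpha_i)=\alpha(q)$, and let $k\ge1$ be the smallest integer such that $\alpha_{k+1}\alpha_{k+2}\cdots=\overline{\alpha_1\alpha_2\cdots}$ (such $k$ exists). (i) The sets $\mathcal U_q$ and $\mathcal V_q$ are closed. (ii) $|\mathcal V_q\setminus\mathcal U_q|=\aleph_0$ and $\mathcal V_q\setminus\mathcal U_q$ is a discrete set, dense in $\mathcal V_q$. (iii) Each $x\in\mathcal V_q\setminus\mathcal U_q$ has exactly $\aleph_0$ expansions and a finite greedy expansion. (iv) Let $x\in\mathcal V_q\setminus\mathcal U_q$ and let $b_n$ be the last nonzero element of $(b_i)=b(x,q)$. Then $x$ has exactly $\aleph_0$ other expansions of the form $(b_1\cdots b_n)^-d_{n+1}d_{n+2}\cdots$, where $d_{n+1}d_{n+2}\cdots$ is one of the expansions of $1$ in base $q$. Furthermore, if $q=\tilde q$, $M$ is even and $b_n\ge2$, then $b_1\cdots b_{n-1}(b_n-2)M^\infty$ is also an expansion of $x$. Finally, if $n>k$, $b_{n-k}>0$ and $b_{n-k+1}\cdots b_n=\overline{(\alpha_1\cdots\alpha_k)^-}$, then $x$ has one more expansion: $(b_1\cdots b_{n-k})^-M^\infty$.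
   Context: Fix a positive integer $M$, $A=\{0,1,\dots,M\}$, sequences are elements of $A^{\mathbb N}$, ordered lexicographically. For a digit $c$, $\overline c=M-c$; reflections of words and sequences are digitwise. For a word $w=c_1\cdots c_n$ with $c_n>0$, $w^-=c_1\cdots c_{n-1}(c_n-1)$. A sequence is finite if it has a last nonzero digit, infinite otherwise; doubly infinite if both it and its reflection are infinite. For $q\in(1,M+1]$ an expansion of $x$ in base $q$ is $(c_i)\in A^{\mathbb N}$ with $\sum c_iq^{-i}=x$; $J_q=[0,M/(q-1)]$. $b(x,q)$ (greedy) is the lexicographically largest expansion of $x$, $a(x,q)$ (quasi-greedy) the lexicographically largest infinite expansion; $\alpha(q)=a(1,q)$. $\mathcal U$ (resp. $\mathcal V$) is the set of $q>1$ such that $1$ has a unique expansion (resp. a unique doubly infinite expansion) in base $q$; $\overline{\mathcal U}$ is the closure of $\mathcal U$; all lie in $(1,M+1]$. $\tilde q=\min\mathcal V$; explicitly $\tilde q=m+1$ if $M=2m$ and $\tilde q=(m+\sqrt{m^2+4m})/2$ if $M=2m-1$. $\mathcal U_q$ is the set of $x\in J_q$ with a unique expansion; for $q<M+1$, $\mathcal V_q$ is the set of $x\in J_q$ with a unique doubly infinite expansion, and $\mathcal V_{M+1}=[0,1]$. *)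

theory Defs
  imports
    "HOL-Analysis.Analysis"
    "HOL-Library.Stream"
    "HOL-Library.Fun_Lexorder"
    "HOL-Library.Equipollence"
begin

text \<open>
  The alphabet is \<open>{0..M}\<close>, with digits of type \<open>nat\<close>, and a sequence \<open>c\<^sub>1 c\<^sub>2 \<dots>\<close> over it is a
  stream.  Stream positions start at \<open>0\<close>, so the digit \<open>c\<^sub>i\<close> is \<open>c !! (i - 1)\<close>, the word
  \<open>c\<^sub>1 \<dots> c\<^sub>n\<close> is \<open>stake n c\<close>, and the tail \<open>c\<^sub>n\<^sub>+\<^sub>1 c\<^sub>n\<^sub>+\<^sub>2 \<dots>\<close> is \<open>sdrop n c\<close>.
\<close>

definition reflect :: "nat \<Rightarrow> nat stream \<Rightarrow> nat stream" where
  "reflect M c = smap (\<lambda>d. M - d) c"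

definition reflect_word :: "nat \<Rightarrow> nat list \<Rightarrow> nat list" where
  "reflect_word M w = map (\<lambda>d. M - d) w"

text \<open>The word \<open>w\<^sup>-\<close>; meaningful only if \<open>w\<close> is nonempty with a positive last digit.\<close>

definition decr_last :: "nat list \<Rightarrow> nat list" where
  "decr_last w = butlast w @ [last w - 1]"

definition last_nonzero_at :: "nat stream \<Rightarrow> nat \<Rightarrow> bool" where
  "last_nonzero_at c n \<longleftrightarrow> 1 \<le> n \<and> c !! (n - 1) \<noteq> 0 \<and> (\<forall>i>n. c !! (i - 1) = 0)"

text \<open>By this convention the zero sequence is infinite.\<close>

definition finite_seq :: "nat stream \<Rightarrow> bool" where
  "finite_seq c \<longleftrightarrow> (\<exists>n. last_nonzero_at c n)"

abbreviation infinite_seq :: "nat stream \<Rightarrow> bool" where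
  "infinite_seq c \<equiv> \<not> finite_seq c"

definition doubly_infinite :: "nat \<Rightarrow> nat stream \<Rightarrow> bool" where
  "doubly_infinite M c \<longleftrightarrow> infinite_seq c \<and> infinite_seq (reflect M c)"

definition lex_greatest :: "nat stream set \<Rightarrow> nat stream" where
  "lex_greatest S = (THE c. c \<in> S \<and> (\<forall>d\<in>S. d \<noteq> c \<longrightarrow> less_fun (snth d) (snth c)))"

definition expansions :: "nat \<Rightarrow> real \<Rightarrow> real \<Rightarrow> nat stream set" where
  "expansions M q x = {c \<in> streams {0..M}. (\<lambda>i. real (c !! i) / q ^ Suc i) sums x}"

definition J :: "nat \<Rightarrow> real \<Rightarrow> real set" where
  "J M q = {0 .. real M / (q - 1)}"

definition greedy :: "nat \<Rightarrow> real \<Rightarrow> real \<Rightarrow> nat stream" where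
  "greedy M q x = lex_greatest (expansions M q x)"

definition quasi_greedy :: "nat \<Rightarrow> real \<Rightarrow> real \<Rightarrow> nat stream" where
  "quasi_greedy M q x = lex_greatest {c \<in> expansions M q x. infinite_seq c}"

definition unique_bases :: "nat \<Rightarrow> real set" where
  "unique_bases M = {q. 1 < q \<and> (\<exists>!c. c \<in> expansions M q 1)}"

definition doubly_unique_bases :: "nat \<Rightarrow> real set" where
  "doubly_unique_bases M =
     {q. 1 < q \<and> (\<exists>!c. c \<in> expansions M q 1 \<and> doubly_infinite M c)}"

definition q_tilde :: "nat \<Rightarrow> real" where
  "q_tilde M = (LEAST q. q \<in> doubly_unique_bases M)"

definition U :: "nat \<Rightarrow> real \<Rightarrow> real set" where
  "U M q = {x \<in> J M q. \<exists>!c. c \<in> expansions M q x}"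

definition V :: "nat \<Rightarrow> real \<Rightarrow> real set" where
  "V M q = (if q = real M + 1 then {0..1}
            else {x \<in> J M q. \<exists>!c. c \<in> expansions M q x \<and> doubly_infinite M c})"

end

theory Submission
  imports Defs
begin

text \<open>
  For \<open>q < M + 1\<close>, the points of \<open>V\<^sub>q\<close> and \<open>U\<^sub>q\<close> correspond to the sequences all of whose tails lie,
  weakly respectively strictly, between the reflection of \<open>\<alpha>(q)\<close> and \<open>\<alpha>(q)\<close>, each bound being
  imposed only after digits that leave room for a change.

  If no tail of \<open>\<alpha>(q)\<close> equals its reflection, arbitrarily long prefixes of \<open>\<alpha>(q)\<close> generate
  Thue--Morse-like sequences that are the unique expansions of \<open>1\<close> in bases close to \<open>q\<close>; so \<open>k\<close> exists
  when \<open>q \<notin> closure U\<close>.  Then \<open>\<alpha>(q) = (w w')\<^sup>\<infinity>\<close>, where \<open>w'\<close> is the reflection of the word \<open>w\<close> of length \<open>k\<close>,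
  and a sequence of \<open>V\<^sub>q\<close> that contains \<open>w\<close> at a place where the upper bound applies must continue as
  \<open>\<alpha>(q)\<close>.  Hence \<open>U\<^sub>q\<close> is given by finitely many forbidden words, which makes it closed, and the other
  points of \<open>V\<^sub>q\<close> are isolated; replacing suitable tails by \<open>\<alpha>(q)\<close> shows that they are dense.
\<close>

section \<open>Lexicographic order on digit sequences\<close>

text \<open>Order and value are linked through remainders: if \<open>c\<close> satisfies
  \<open>quasi\<close>, a lexicographically larger sequence has at least the same value, and the
  same value only if it ends in zeros. Hence every expansion of a point of V_q other than its doubly
  infinite one ends in 0^inf or in M^inf, which gives the countability claims. Reflection exchanges
  the two bounds, so lower bounds are treated as upper bounds for \<open>mirror M c\<close>.
  Topology is done on sequences: \<open>digits M\<close> is compact, \<open>val q\<close> is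
  continuous on it and injective on \<open>V_seqs\<close>. So it suffices to show sets of sequences
  closed; isolation of a point is expressed by the closedness of \<open>V_seqs\<close> without it.
  The base \<open>M + 1\<close> lies in U and is thereby excluded; below it M^inf has value greater
  than 1, so that \<open>\<alpha>\<close> differs from M^inf.\<close>

definition digits :: "nat \<Rightarrow> (nat \<Rightarrow> nat) set" where
  "digits M = {c. \<forall>i. c i \<le> M}"

definition tail :: "nat \<Rightarrow> (nat \<Rightarrow> nat) \<Rightarrow> nat \<Rightarrow> nat" where
  "tail n c = (\<lambda>i. c (n + i))"

definition mirror :: "nat \<Rightarrow> (nat \<Rightarrow> nat) \<Rightarrow> nat \<Rightarrow> nat" where
  "mirror M c = (\<lambda>i. M - c i)"

abbreviation lex_less (infix "\<sqsubset>" 50) where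
  "c \<sqsubset> d \<equiv> less_fun c (d :: nat \<Rightarrow> nat)"

definition lex_le (infix "\<sqsubseteq>" 50) where
  "c \<sqsubseteq> (d :: nat \<Rightarrow> nat) \<longleftrightarrow> less_fun c d \<or> c = d"

lemma lex_less_linear:
  fixes c d :: "nat \<Rightarrow> nat"
  shows "c \<sqsubset> d \<or> c = d \<or> d \<sqsubset> c"
proof (cases "c = d")
  case False
  then obtain i where "c i \<noteq> d i" by auto
  define j where "j = (LEAST i. c i \<noteq> d i)"
  have "c j \<noteq> d j" unfolding j_def using \<open>c i \<noteq> d i\<close> by (rule LeastI)
  moreover have "\<forall>i<j. c i = d i" unfolding j_def using not_less_Least by blast
  ultimately show ?thesis
    unfolding less_fun_def by (metis linorder_neq_iff)
qed simp

interpretation lex: linorder lex_le "less_fun :: (nat \<Rightarrow> nat) \<Rightarrow> _"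
  by unfold_locales
    (auto simp: lex_le_def less_fun_irrefl dest: less_fun_asym less_fun_trans,
     use lex_less_linear in blast)

lemma tail_0 [simp]: "tail 0 c = c"
  by (simp add: tail_def)

lemma tail_tail [simp]: "tail m (tail n c) = tail (n + m) c"
  by (simp add: tail_def add.assoc)

lemma tail_apply: "tail n c i = c (n + i)"
  by (simp add: tail_def)

lemma mirror_apply: "mirror M c i = M - c i"
  by (simp add: mirror_def)

lemma mirror_tail: "mirror M (tail n c) = tail n (mirror M c)"
  by (simp add: mirror_def tail_def)

lemma digits_le: "c \<in> digits M \<Longrightarrow> c i \<le> M"
  by (simp add: digits_def)

lemma tail_digits [simp]: "c \<in> digits M \<Longrightarrow> tail n c \<in> digits M"
  by (simp add: digits_def tail_apply)

lemma mirror_digits [simp]: "mirror M c \<in> digits M"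
  by (simp add: digits_def mirror_apply)

lemma mirror_mirror [simp]: "c \<in> digits M \<Longrightarrow> mirror M (mirror M c) = c"
  by (auto simp: digits_def mirror_def)

lemma mirror_eq_iff: "c \<in> digits M \<Longrightarrow> d \<in> digits M \<Longrightarrow> mirror M c = mirror M d \<longleftrightarrow> c = d"
  by (metis mirror_mirror)

lemma mirror_less_mirror:
  assumes "c \<in> digits M" "d \<in> digits M"
  shows "mirror M c \<sqsubset> mirror M d \<longleftrightarrow> d \<sqsubset> c"
proof -
  have "M - c i < M - d i \<longleftrightarrow> d i < c i" "M - c i = M - d i \<longleftrightarrow> d i = c i" for i
    using digits_le[OF assms(1), of i] digits_le[OF assms(2), of i] by auto
  then show ?thesis by (simp add: less_fun_def mirror_apply)
qed

lemma mirror_le_mirror: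
  assumes "c \<in> digits M" "d \<in> digits M"
  shows "mirror M c \<sqsubseteq> mirror M d \<longleftrightarrow> d \<sqsubseteq> c"
  using mirror_less_mirror[OF assms] mirror_eq_iff[OF assms] by (auto simp: lex_le_def)

lemma mirror_le_iff:
  assumes "c \<in> digits M" "d \<in> digits M"
  shows "mirror M c \<sqsubseteq> d \<longleftrightarrow> mirror M d \<sqsubseteq> c"
  using mirror_le_mirror[of c M "mirror M d"] assms by simp

lemma lex_less_agree:
  assumes "\<forall>i<n. c i = d i"
  shows "tail n c \<sqsubset> tail n d \<longleftrightarrow> c \<sqsubset> d"
proof
  assume "c \<sqsubset> d"
  then obtain j where j: "c j < d j" "\<forall>i<j. c i = d i" by (auto simp: less_fun_def)
  with assms have "n \<le> j" by (metis less_irrefl_nat not_le)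
  with j show "tail n c \<sqsubset> tail n d"
    unfolding less_fun_def by (intro exI[of _ "j - n"]) (auto simp: tail_apply)
next
  assume "tail n c \<sqsubset> tail n d"
  then obtain j where j: "c (n + j) < d (n + j)" "\<forall>i<j. c (n + i) = d (n + i)"
    by (auto simp: less_fun_def tail_apply)
  have "c i = d i" if "i < n + j" for i
    using assms j(2) that by (cases "i < n") (auto dest: spec[of _ "i - n"])
  with j(1) show "c \<sqsubset> d" by (auto simp: less_fun_def)
qed

lemma agree_eqI: "\<forall>i<n. c i = d i \<Longrightarrow> tail n c = tail n d \<Longrightarrow> c = d"
  by (metis lex_less_agree lex_less_linear less_fun_irrefl)

lemma lex_le_agree: "\<forall>i<n. c i = d i \<Longrightarrow> tail n c \<sqsubseteq> tail n d \<longleftrightarrow> c \<sqsubseteq> d"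
  using lex_less_agree agree_eqI by (metis lex_le_def)

text \<open>The first difference lies below \<open>n\<close>, so the first \<open>n\<close> digits
  alone decide the comparison, whatever is grafted on behind them.\<close>

lemma lex_less_prefix_cong:
  assumes "c \<sqsubset> d" "\<not> (\<forall>i<n. c i = d i)" "\<forall>i<n. c' i = c i" "\<forall>i<n. d' i = d i"
  shows "c' \<sqsubset> d'"
proof -
  obtain j where j: "c j < d j" "\<forall>i<j. c i = d i" using assms(1) by (auto simp: less_fun_def)
  with assms(2) have "j < n" by (metis less_trans linorder_neqE_nat)
  with j assms(3,4) show ?thesis by (auto simp: less_fun_def intro!: exI[of _ j])
qed

lemma lex_squeeze:
  assumes "a \<sqsubseteq> b" "b \<sqsubseteq> c" "\<forall>i<n. a i = c i"
  shows "\<forall>i<n. b i = c i"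
proof (rule ccontr)
  assume neq: "\<not> ?thesis"
  then have "b \<sqsubset> c" using assms(2) by (auto simp: lex_le_def)
  then have "b \<sqsubset> a" by (rule lex_less_prefix_cong) (use neq assms(3) in auto)
  with assms(1) show False by (simp add: lex.leD)
qed

lemma lex_le_const: "c \<in> digits M \<Longrightarrow> c \<sqsubseteq> (\<lambda>_. M)"
  by (metis lex.linear lex_le_def less_fun_def digits_le not_less)

lemma zero_lex_le: "(\<lambda>_. 0) \<sqsubseteq> c"
  by (metis lex.not_less less_fun_def not_less_zero)

text \<open>Up to the first difference between \<open>c\<close> and its shift all digits of
  \<open>c\<close> equal \<open>M\<close>, which leaves no room for the shift to be larger
  there.\<close>

lemma tail_Suc_0_lex_le:
  assumes "c \<in> digits M" "c 0 = M"
  shows "tail 1 c \<sqsubseteq> c"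
proof (rule ccontr)
  assume "\<not> ?thesis"
  then have "c \<sqsubset> tail 1 c" by auto
  then obtain j where j: "c j < c (Suc j)" "\<forall>i<j. c i = c (Suc i)"
    by (auto simp: less_fun_def tail_apply)
  have "i \<le> j \<Longrightarrow> c i = M" for i using j(2) assms(2) by (induction i) auto
  with j(1) digits_le[OF assms(1)] show False by (metis not_le order_refl)
qed

text \<open>Removes the side condition \<open>c n < M\<close>: dropping a leading digit
  \<open>M\<close> never increases a sequence, so the bound is inherited across such digits.\<close>

lemma tail_lex_le:
  assumes "c \<in> digits M" "\<And>n. c n < M \<Longrightarrow> tail (Suc n) c \<sqsubseteq> \<gamma>" "c \<sqsubseteq> \<gamma>"
  shows "tail n c \<sqsubseteq> \<gamma>"
proof (induction n)
  case (Suc n)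
  show ?case
  proof (cases "c n < M")
    case False
    then have "tail n c 0 = M" using digits_le[OF assms(1), of n] by (simp add: tail_apply)
    then have "tail 1 (tail n c) \<sqsubseteq> tail n c" using assms(1) by (intro tail_Suc_0_lex_le) auto
    then have "tail (Suc n) c \<sqsubseteq> tail n c" by simp
    then show ?thesis using Suc by (rule lex.order_trans)
  qed (use assms(2) in auto)
qed (use assms(3) in simp)

section \<open>Values and expansions\<close>

definition val :: "real \<Rightarrow> (nat \<Rightarrow> nat) \<Rightarrow> real" where
  "val q c = (\<Sum>i. real (c i) / q ^ Suc i)"

definition terminates :: "(nat \<Rightarrow> nat) \<Rightarrow> bool" where
  "terminates c \<longleftrightarrow> (\<exists>n. c n \<noteq> 0 \<and> (\<forall>i>n. c i = 0))"

text \<open>A digit below \<open>M\<close> followed by a value at most 1 cannot be raised so as to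
  leave a positive remainder. This is the remainder form of being quasi-greedy; that the sequence is
  infinite is always demanded separately.\<close>

definition quasi :: "nat \<Rightarrow> real \<Rightarrow> (nat \<Rightarrow> nat) \<Rightarrow> bool" where
  "quasi M q c \<longleftrightarrow> c \<in> digits M \<and> (\<forall>n. c n < M \<longrightarrow> val q (tail (Suc n) c) \<le> 1)"

lemma terminates_tail: "terminates (tail n c) \<Longrightarrow> terminates c"
  unfolding terminates_def tail_def
  by (metis le_add1 le_add_diff_inverse less_imp_le_nat nat_add_left_cancel_less order_trans)

lemma const_sums:
  assumes "1 < q"
  shows "(\<lambda>i. real M / q ^ Suc i) sums (M / (q - 1))"
proof -
  have "(\<lambda>i. (real M / q) * (1 / q) ^ i) sums (real M / q * (1 / (1 - 1 / q)))"
    using assms by (intro sums_mult geometric_sums) auto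
  moreover have "q * (1 - 1 / q) = q - 1" using assms by (simp add: algebra_simps)
  ultimately show ?thesis by (simp add: power_divide)
qed

lemma val_sums:
  assumes "c \<in> digits M" "1 < q"
  shows "(\<lambda>i. real (c i) / q ^ Suc i) sums val q c"
proof -
  have "summable (\<lambda>i. real (c i) / q ^ Suc i)"
  proof (rule summable_comparison_test')
    show "summable (\<lambda>i. real M / q ^ Suc i)" using const_sums[OF assms(2)] by (rule sums_summable)
    show "norm (real (c i) / q ^ Suc i) \<le> real M / q ^ Suc i" if "i \<ge> 0" for i
      using assms digits_le[OF assms(1), of i] by (simp add: divide_right_mono)
  qed
  then show ?thesis unfolding val_def by (rule summable_sums)
qed

lemma val_const: "1 < q \<Longrightarrow> val q (\<lambda>_. M) = M / (q - 1)"
  unfolding val_def by (rule sums_unique[symmetric, OF const_sums])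

lemma val_mirror:
  assumes "c \<in> digits M" "1 < q"
  shows "val q (mirror M c) = M / (q - 1) - val q c"
proof -
  have "(\<lambda>i. real M / q ^ Suc i - real (c i) / q ^ Suc i) sums (M / (q - 1) - val q c)"
    using const_sums val_sums assms by (intro sums_diff) auto
  then show ?thesis
    using digits_le[OF assms(1)]
    by (simp add: val_def mirror_def of_nat_diff diff_divide_distrib sums_iff)
qed

lemma val_nonneg: "c \<in> digits M \<Longrightarrow> 1 < q \<Longrightarrow> 0 \<le> val q c"
  by (rule sums_le[OF _ sums_zero val_sums]) auto

lemma val_le: "c \<in> digits M \<Longrightarrow> 1 < q \<Longrightarrow> val q c \<le> M / (q - 1)"
  using val_mirror[of c M q] val_nonneg[of "mirror M c" M q] by simp

lemma val_eq_0_iff: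
  assumes "c \<in> digits M" "1 < q"
  shows "val q c = 0 \<longleftrightarrow> c = (\<lambda>_. 0)"
proof -
  have "val q c = 0 \<longleftrightarrow> (\<forall>i. real (c i) / q ^ Suc i = 0)"
    unfolding val_def using val_sums[OF assms] assms(2)
    by (intro suminf_eq_zero_iff) (auto simp: sums_iff)
  then show ?thesis using assms(2) by (auto simp: fun_eq_iff)
qed

lemma val_tail_pos:
  assumes "c \<in> digits M" "1 < q" "\<not> terminates c" "c \<noteq> (\<lambda>_. 0)"
  shows "0 < val q (tail n c)"
proof (rule ccontr)
  assume "\<not> ?thesis"
  then have "val q (tail n c) = 0" using val_nonneg[of "tail n c" M q] assms by simp
  then have "tail n c = (\<lambda>_. 0)" using val_eq_0_iff assms by (metis tail_digits)
  then have z: "c i = 0" if "i \<ge> n" for i using that by (metis le_add_diff_inverse tail_apply)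
  obtain j where "c j \<noteq> 0" using assms(4) by auto
  then have ne: "{i. c i \<noteq> 0} \<noteq> {}" by auto
  have "{i. c i \<noteq> 0} \<subseteq> {..<n}" by (rule subsetI, rule ccontr) (use z in auto)
  then have fin: "finite {i. c i \<noteq> 0}" by (rule finite_subset) simp
  have "c (Max {i. c i \<noteq> 0}) \<noteq> 0" using Max_in[OF fin ne] by simp
  moreover have "c i = 0" if "i > Max {i. c i \<noteq> 0}" for i
    using Max_ge[OF fin, of i] that by auto
  ultimately show False using assms(3) unfolding terminates_def by blast
qed

lemma val_split:
  assumes "c \<in> digits M" "1 < q"
  shows "val q c = (\<Sum>i<n. real (c i) / q ^ Suc i) + val q (tail n c) / q ^ n"
proof -
  have "val q c = (\<Sum>i. real (c (i + n)) / q ^ Suc (i + n)) + (\<Sum>i<n. real (c i) / q ^ Suc i)"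
    unfolding val_def using val_sums[OF assms]
      by (intro suminf_split_initial_segment) (rule sums_summable)
  also have "(\<lambda>i. real (c (i + n)) / q ^ Suc (i + n)) = (\<lambda>i. real (tail n c i) / q ^ Suc i / q ^ n)"
    by (auto simp: tail_apply power_add add.commute mult_ac)
  also have "(\<Sum>i. real (tail n c i) / q ^ Suc i / q ^ n) = val q (tail n c) / q ^ n"
    unfolding val_def using val_sums[of "tail n c" M q] assms
    by (intro suminf_divide) (auto simp: sums_iff)
  finally show ?thesis by simp
qed

text \<open>The common prefix cancels and scaling isolates the first digits that may differ; this
  identity is the bridge from lexicographic comparison to values.\<close>

lemma val_compare:
  assumes "c \<in> digits M" "d \<in> digits M" "1 < q" "\<forall>i<n. c i = d i"
  shows "q ^ Suc n * (val q d - val q c) =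
    real (d n) - real (c n) + val q (tail (Suc n) d) - val q (tail (Suc n) c)"
proof -
  have "(\<Sum>i<n. real (c i) / q ^ Suc i) = (\<Sum>i<n. real (d i) / q ^ Suc i)" using assms(4) by simp
  then show ?thesis
    using assms(3) val_split[of d M q "Suc n"] val_split[of c M q "Suc n"] assms(1,2)
    by (simp add: field_simps)
qed

lemma val_agree:
  assumes "c \<in> digits M" "d \<in> digits M" "1 < q" "\<forall>i<n. c i = d i"
  shows "\<bar>val q d - val q c\<bar> \<le> M / (q - 1) / q ^ n"
proof -
  have "(\<Sum>i<n. real (c i) / q ^ Suc i) = (\<Sum>i<n. real (d i) / q ^ Suc i)" using assms(4) by simp
  then have "val q d - val q c = (val q (tail n d) - val q (tail n c)) / q ^ n"
    using assms val_split[of d M q n] val_split[of c M q n] by (simp add: diff_divide_distrib)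
  moreover have "\<bar>val q (tail n d) - val q (tail n c)\<bar> \<le> M / (q - 1)"
    using assms val_le[of "tail n d" M q] val_nonneg[of "tail n d" M q]
      val_le[of "tail n c" M q] val_nonneg[of "tail n c" M q] by (auto simp: abs_le_iff)
  ultimately show ?thesis using assms(3)
    by (simp add: abs_divide divide_right_mono del: divide_divide_eq_left)
qed

text \<open>The partial sums telescope to \<open>r 0 - r n / q ^ n\<close>, and bounded remainders
  vanish after division by \<open>q ^ n\<close>.\<close>

lemma remainders_sums:
  assumes "1 < q" "\<And>n. r (Suc n) = q * r n - real (c n)" "\<And>n. \<bar>r n\<bar> \<le> B"
  shows "(\<lambda>i. real (c i) / q ^ Suc i) sums r 0"
proof -
  have part: "(\<Sum>i<n. real (c i) / q ^ Suc i) = r 0 - r n / q ^ n" for n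
  proof (induction n)
    case (Suc n)
    then show ?case using assms(1) by (simp add: assms(2) diff_divide_distrib)
  qed simp
  have "(\<lambda>n. r n * (1 / q) ^ n) \<longlonglongrightarrow> 0"
  proof (rule Lim_null_comparison)
    show "\<forall>\<^sub>F n in sequentially. norm (r n * (1 / q) ^ n) \<le> B * (1 / q) ^ n"
      using assms by (auto simp: abs_mult power_divide intro!: always_eventually divide_right_mono)
    show "(\<lambda>n. B * (1 / q) ^ n) \<longlonglongrightarrow> 0"
      using assms(1) by (intro tendsto_mult_right_zero LIMSEQ_power_zero) auto
  qed
  then have "(\<lambda>n. r 0 - r n / q ^ n) \<longlonglongrightarrow> r 0 - 0"
    by (intro tendsto_diff) (auto simp: power_divide)
  then show ?thesis unfolding sums_def part by simp
qed

text \<open>A common frame for the greedy and the quasi-greedy algorithm: \<open>S\<close> holds the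
  remainders that may occur at all, \<open>T\<close> those allowed after a digit below
  \<open>M\<close>. Since \<open>S\<close> is bounded, the remainder at stage \<open>n\<close> is
  the value of the \<open>n\<close>-th tail.\<close>

lemma expansion_algorithm:
  fixes S T :: "real set"
  assumes "1 < q" "S \<subseteq> {0..B}" "x \<in> S"
    and step: "\<And>r. r \<in> S \<Longrightarrow> \<exists>d\<le>M. q * r - real d \<in> S \<and> (d < M \<longrightarrow> q * r - real d \<in> T)"
  obtains c where "c \<in> digits M" "val q c = x" "\<And>n. val q (tail n c) \<in> S"
    "\<And>n. c n < M \<Longrightarrow> val q (tail (Suc n) c) \<in> T"
proof -
  obtain \<delta> :: "real \<Rightarrow> nat" where \<delta>: "\<And>r. r \<in> S \<Longrightarrow> \<delta> r \<le> M \<and> q * r - \<delta> r \<in> S \<and> (\<delta> r < M \<longrightarrow> q * r - \<delta> r \<in> T)"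
    using step by metis
  define r where "r n = ((\<lambda>r. q * r - \<delta> r) ^^ n) x" for n
  define c where "c n = \<delta> (r n)" for n
  have rS: "r n \<in> S" for n unfolding r_def using assms(3) \<delta> by (induction n) auto
  have r0: "r 0 = x" and rSuc: "r (Suc n) = q * r n - real (c n)" for n
    by (auto simp: r_def c_def)
  have "(\<lambda>i. real (tail n c i) / q ^ Suc i) sums r n" for n
  proof -
    have "\<bar>r (n + i)\<bar> \<le> B" for i using rS[of "n + i"] assms(2) by auto
    then show ?thesis
      using remainders_sums[of q "\<lambda>i. r (n + i)" "tail n c" B] assms(1) rSuc
        by (simp add: tail_apply)
  qed
  then have val: "val q (tail n c) = r n" for n by (simp add: val_def sums_iff)
  show ?thesis
  proof
    show "c \<in> digits M" using \<delta> rS by (simp add: digits_def c_def)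
    show "val q c = x" using val[of 0] r0 by simp
    show "val q (tail n c) \<in> S" for n using val rS by simp
    show "val q (tail (Suc n) c) \<in> T" if "c n < M" for n
      using \<delta>[OF rS, of n] that rSuc unfolding val by (simp add: c_def)
  qed
qed

text \<open>The largest value \<open>M / (q - 1)\<close> is the fixed point of the map that sends
  \<open>r\<close> to \<open>q * r - M\<close>.\<close>

lemma remainder_le:
  assumes "1 < q" "r \<le> real M / (q - 1)"
  shows "q * r - real M \<le> real M / (q - 1)"
proof -
  have "q * r \<le> q * (real M / (q - 1))" using assms by (intro mult_left_mono) auto
  also have "\<dots> = real M / (q - 1) + real M" using assms(1) by (simp add: field_simps)
  finally show ?thesis by simp
qed

lemma ex_quasi_expansion:
  assumes "1 < q" "q \<le> real M + 1" "0 < x" "x \<le> real M / (q - 1)"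
  obtains c where "quasi M q c" "val q c = x" "\<not> terminates c"
proof -
  \<comment> \<open>Here \<open>q \<le> M + 1\<close> enters: a remainder of at most 1 is small
    enough to be expanded further.\<close>
  have 1: "1 \<le> real M / (q - 1)" using assms by (simp add: field_simps)
  have step: "\<exists>d\<le>M. q * r - real d \<in> {0<..real M / (q - 1)} \<and> (d < M \<longrightarrow> q * r - real d \<in> {..1})"
    if r: "r \<in> {0<..real M / (q - 1)}" for r
  proof (cases "q * r > M")
    case True
    then show ?thesis using r remainder_le[OF assms(1), of r M] by (intro exI[of _ M]) auto
  next
    case False
    \<comment> \<open>The largest integer strictly below \<open>q * r\<close>, so that the next
      remainder lies in (0, 1] and never becomes zero.\<close>
    define d where "d = nat (\<lceil>q * r\<rceil> - 1)"
    have "0 < q * r" using r assms(1) by simp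
    then have "real d < q * r" "q * r \<le> real d + 1" unfolding d_def by linarith+
    then show ?thesis using False 1 by (intro exI[of _ d]) auto
  qed
  obtain c where c: "c \<in> digits M" "val q c = x" "\<And>n. val q (tail n c) \<in> {0<..real M / (q - 1)}"
    "\<And>n. c n < M \<Longrightarrow> val q (tail (Suc n) c) \<in> {..1}"
    by (rule expansion_algorithm[OF assms(1), of "{0<..real M / (q - 1)}" "real M / (q - 1)" x M "{..1}"])
      (use assms step in auto)
  have "\<not> terminates c"
  proof
    assume "terminates c"
    then obtain n where "\<forall>i>n. c i = 0" by (auto simp: terminates_def)
    then have "tail (Suc n) c = (\<lambda>_. 0)" by (auto simp: tail_def)
    then show False using c(3)[of "Suc n"] by (simp add: val_def)
  qed
  with c that show ?thesis by (auto simp: quasi_def)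
qed

lemma ex_greedy_expansion:
  assumes "1 < q" "q \<le> real M + 1" "0 \<le> x" "x \<le> real M / (q - 1)"
  obtains c where "c \<in> digits M" "val q c = x" "\<And>n. c n < M \<Longrightarrow> val q (tail (Suc n) c) < 1"
proof -
  have 1: "1 \<le> real M / (q - 1)" using assms by (simp add: field_simps)
  have step: "\<exists>d\<le>M. q * r - real d \<in> {0..real M / (q - 1)} \<and> (d < M \<longrightarrow> q * r - real d \<in> {..<1})"
    if r: "r \<in> {0..real M / (q - 1)}" for r
  proof (cases "q * r \<ge> M")
    case True
    then show ?thesis using r remainder_le[OF assms(1), of r M] by (intro exI[of _ M]) auto
  next
    case False
    \<comment> \<open>Rounding down instead puts the next remainder into [0, 1) and permits finite
      expansions.\<close>
    define d where "d = nat \<lfloor>q * r\<rfloor>"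
    have "0 \<le> q * r" using r assms(1) by simp
    then have "real d \<le> q * r" "q * r < real d + 1" unfolding d_def by linarith+
    then show ?thesis using False 1 by (intro exI[of _ d]) auto
  qed
  obtain c where "c \<in> digits M" "val q c = x"
    "\<And>n. c n < M \<Longrightarrow> val q (tail (Suc n) c) \<in> {..<1}"
    by (rule expansion_algorithm[OF assms(1), of "{0..real M / (q - 1)}" "real M / (q - 1)" x M "{..<1}"])
      (use assms step in auto)
  with that show ?thesis by auto
qed

text \<open>At the first difference \<open>c\<close> loses at least 1 to \<open>d\<close> and can
  regain at most 1 through its tail. Equality leaves nothing for the tail of \<open>d\<close>, which
  is then zero.\<close>

lemma quasi_less:
  assumes "quasi M q c" "d \<in> digits M" "1 < q" "c \<sqsubset> d"
  shows "val q c \<le> val q d" "val q d = val q c \<Longrightarrow> terminates d"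
proof -
  obtain n where n: "c n < d n" "\<forall>i<n. c i = d i" using assms(4) by (auto simp: less_fun_def)
  have c: "c \<in> digits M" using assms(1) by (simp add: quasi_def)
  have "c n < M" using n(1) digits_le[OF assms(2), of n] by simp
  then have le1: "val q (tail (Suc n) c) \<le> 1" using assms(1) by (simp add: quasi_def)
  have nonneg: "0 \<le> val q (tail (Suc n) d)"
    by (rule val_nonneg[OF tail_digits[OF assms(2)] assms(3)])
  note eq = val_compare[OF c assms(2,3) n(2)]
  have "0 \<le> q ^ Suc n * (val q d - val q c)" unfolding eq using n(1) le1 nonneg by linarith
  then show "val q c \<le> val q d" using assms(3)
    by (simp add: zero_le_mult_iff power_le_zero_eq del: power_Suc)
  assume "val q d = val q c"
  then have "val q (tail (Suc n) d) = 0" using eq n(1) le1 nonneg by simp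
  then have "tail (Suc n) d = (\<lambda>_. 0)" using val_eq_0_iff assms(2,3) by (metis tail_digits)
  then have "d i = 0" if "i > n" for i using that by (metis Suc_leI le_add_diff_inverse tail_apply)
  with n(1) show "terminates d" unfolding terminates_def by (metis not_less_zero)
qed

lemma greedy_less:
  assumes "c \<in> digits M" "\<And>n. c n < M \<Longrightarrow> val q (tail (Suc n) c) < 1"
    "d \<in> digits M" "1 < q" "c \<sqsubset> d"
  shows "val q c < val q d"
proof -
  obtain n where n: "c n < d n" "\<forall>i<n. c i = d i" using assms(5) by (auto simp: less_fun_def)
  have "c n < M" using n(1) digits_le[OF assms(3), of n] by simp
  then have "val q (tail (Suc n) c) < 1" by (rule assms(2))
  moreover have "0 \<le> val q (tail (Suc n) d)"
    by (rule val_nonneg[OF tail_digits[OF assms(3)] assms(4)])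
  ultimately have "0 < q ^ Suc n * (val q d - val q c)"
    unfolding val_compare[OF assms(1,3,4) n(2)] using n(1) by linarith
  then show ?thesis using assms(4) by (simp add: zero_less_mult_iff del: power_Suc)
qed

text \<open>The first condition makes \<open>c\<close> the largest expansion of its value, the
  second makes its reflection the largest, hence \<open>c\<close> the smallest; an expansion is
  unique when it is both.\<close>

lemma unique_expansion_iff:
  assumes "1 < q" "q \<le> real M + 1" "c \<in> digits M"
  shows "(\<forall>d\<in>digits M. val q d = val q c \<longrightarrow> d = c) \<longleftrightarrow>
    (\<forall>n. (c n < M \<longrightarrow> val q (tail (Suc n) c) < 1) \<and>
         (0 < c n \<longrightarrow> val q (mirror M (tail (Suc n) c)) < 1))"
    (is "?unique \<longleftrightarrow> ?rhs")
proof
  assume rhs: ?rhs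
  show ?unique
  proof (intro ballI impI, rule ccontr)
    fix d assume d: "d \<in> digits M" "val q d = val q c" "d \<noteq> c"
    have "\<not> c \<sqsubset> d" using greedy_less[OF assms(3) _ d(1) assms(1)] rhs d(2) by auto
    then have "mirror M c \<sqsubset> mirror M d" using d lex.neq_iff mirror_less_mirror assms(3) by blast
    then have "val q (mirror M c) < val q (mirror M d)"
      by (intro greedy_less[of _ M]) (use rhs assms in \<open>auto simp: mirror_tail mirror_apply\<close>)
    then show False using d val_mirror assms by simp
  qed
next
  assume u: ?unique
  obtain g where g: "g \<in> digits M" "val q g = val q c" "\<And>n. g n < M \<Longrightarrow> val q (tail (Suc n) g) < 1"
    by (rule ex_greedy_expansion[OF assms(1,2), of "val q c"]) (use assms val_le val_nonneg in auto)
  have "g = c" using u g by simp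
  obtain h where h: "h \<in> digits M" "val q h = val q (mirror M c)"
    "\<And>n. h n < M \<Longrightarrow> val q (tail (Suc n) h) < 1"
    by (rule ex_greedy_expansion[OF assms(1,2), of "val q (mirror M c)"])
      (use assms val_le[OF mirror_digits] val_nonneg[OF mirror_digits] in auto)
  have "mirror M h = c" using u h val_mirror assms by simp
  then have "h = mirror M c" using h(1) by auto
  have "mirror M c n < M" if "0 < c n" for n
    using that digits_le[OF assms(3), of n] by (simp add: mirror_apply)
  with \<open>g = c\<close> \<open>h = mirror M c\<close> g(3) h(3) show ?rhs by (auto simp: mirror_tail)
qed

text \<open>An excess over \<open>1\<close> would grow by a factor of at least \<open>q\<close> in passing to the tail after the first
  position at which the sequence leaves \<open>\<gamma>\<close>, while the values of all tails are bounded.\<close>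

lemma lex_le_imp_val:
  assumes "1 < q" "\<gamma> \<in> digits M" "val q \<gamma> = 1" "\<not> terminates \<gamma>"
    and c: "c \<in> digits M" and tails: "\<And>n. c n < M \<Longrightarrow> tail (Suc n) c \<sqsubseteq> \<gamma>"
  shows "tail n c \<sqsubseteq> \<gamma> \<Longrightarrow> val q (tail n c) \<le> 1"
    and "tail n c \<sqsubset> \<gamma> \<Longrightarrow> val q (tail n c) < 1"
proof -
  have first: "\<exists>j. q ^ Suc j * (1 - val q (tail n c)) \<ge> 1 + val q (tail (Suc j) \<gamma>) - val q (tail (n + Suc j) c)
      \<and> tail (n + Suc j) c \<sqsubseteq> \<gamma>" if less: "tail n c \<sqsubset> \<gamma>" for n
  proof -
    obtain j where j: "tail n c j < \<gamma> j" "\<forall>i<j. tail n c i = \<gamma> i"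
      using less by (auto simp: less_fun_def)
    have "c (n + j) < M" using j(1) digits_le[OF assms(2), of j] by (simp add: tail_apply)
    then have "tail (n + Suc j) c \<sqsubseteq> \<gamma>" using tails by simp
    moreover have "q ^ Suc j * (1 - val q (tail n c)) =
        real (\<gamma> j) - real (tail n c j) + val q (tail (Suc j) \<gamma>) - val q (tail (n + Suc j) c)"
      using val_compare[OF tail_digits[OF c] assms(2,1) j(2)] unfolding assms(3) tail_tail .
    ultimately show ?thesis using j(1) by (intro exI[of _ j]) linarith
  qed
  have nz: "\<gamma> \<noteq> (\<lambda>_. 0)" using assms(3) by (auto simp: val_def)
  have pos: "0 < val q (tail j \<gamma>)" for j by (rule val_tail_pos[OF assms(2,1,4) nz])
  have bound: "tail n c \<sqsubseteq> \<gamma> \<Longrightarrow> val q (tail n c) \<le> 1 + M / (q - 1) / q ^ N" for n N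
  proof (induction N arbitrary: n)
    case 0
    then show ?case using val_le[of "tail n c" M q] c assms(1) by simp
  next
    case (Suc N)
    show ?case
    proof (cases "tail n c = \<gamma>")
      case True
      then show ?thesis using assms(1,3) by simp
    next
      case False
      with Suc.prems obtain j where
        j: "q ^ Suc j * (1 - val q (tail n c)) \<ge> 1 + val q (tail (Suc j) \<gamma>) - val q (tail (n + Suc j) c)"
        "tail (n + Suc j) c \<sqsubseteq> \<gamma>" using first lex.le_neq_trans by blast
      have "q ^ Suc j * (1 - val q (tail n c)) \<ge> - (M / (q - 1) / q ^ N)"
        using j(1) pos[of "Suc j"] Suc.IH[OF j(2)] by linarith
      then have "val q (tail n c) \<le> 1 + M / (q - 1) / q ^ N / q ^ Suc j"
        using assms(1) by (simp add: field_simps)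
      also have "\<dots> \<le> 1 + M / (q - 1) / q ^ N / q ^ 1"
        using assms(1) by (intro add_left_mono divide_left_mono power_increasing) auto
      finally show ?thesis by (simp add: field_simps)
    qed
  qed
  show le: "val q (tail n c) \<le> 1" if "tail n c \<sqsubseteq> \<gamma>" for n
  proof (rule LIMSEQ_le_const)
    have "(\<lambda>N. 1 + M / (q - 1) * (1 / q) ^ N) \<longlonglongrightarrow> 1 + M / (q - 1) * 0"
      using assms(1) by (intro tendsto_intros LIMSEQ_power_zero) auto
    then show "(\<lambda>N. 1 + M / (q - 1) / q ^ N) \<longlonglongrightarrow> 1" by (simp add: power_divide)
    show "\<exists>N. \<forall>n'\<ge>N. val q (tail n c) \<le> 1 + M / (q - 1) / q ^ n'" using bound[OF that] by blast
  qed
  assume "tail n c \<sqsubset> \<gamma>"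
  then obtain j where
    j: "q ^ Suc j * (1 - val q (tail n c)) \<ge> 1 + val q (tail (Suc j) \<gamma>) - val q (tail (n + Suc j) c)"
    "tail (n + Suc j) c \<sqsubseteq> \<gamma>" using first by blast
  then have "0 < q ^ Suc j * (1 - val q (tail n c))" using pos[of "Suc j"] le[OF j(2)] by linarith
  then show "val q (tail n c) < 1" using assms(1) by (simp add: zero_less_mult_iff del: power_Suc)
qed

section \<open>Sequences with unique and with unique doubly infinite values\<close>

text \<open>\<open>\<alpha>\<close> is a parameter given by its properties, not fixed as
  \<open>quasi_greedy M q 1\<close>, so that the theory also applies directly to the constant
  sequence that is used to compute \<open>q_tilde\<close>.\<close>

locale quasi_greedy_base =
  fixes M :: nat and q :: real and \<alpha> :: "nat \<Rightarrow> nat"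
  assumes q_gt_1: "1 < q" and q_less: "q < real M + 1"
    and \<alpha>_quasi: "quasi M q \<alpha>" and val_\<alpha>: "val q \<alpha> = 1" and \<alpha>_infinite: "\<not> terminates \<alpha>"
begin

definition U_seqs :: "(nat \<Rightarrow> nat) set" where
  "U_seqs = {c \<in> digits M. \<forall>n. (c n < M \<longrightarrow> tail (Suc n) c \<sqsubset> \<alpha>) \<and>
    (0 < c n \<longrightarrow> mirror M (tail (Suc n) c) \<sqsubset> \<alpha>)}"

definition V_seqs :: "(nat \<Rightarrow> nat) set" where
  "V_seqs = {c \<in> digits M. \<forall>n. (c n < M \<longrightarrow> tail (Suc n) c \<sqsubseteq> \<alpha>) \<and>
    (0 < c n \<longrightarrow> mirror M (tail (Suc n) c) \<sqsubseteq> \<alpha>)}"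

definition doubly :: "(nat \<Rightarrow> nat) \<Rightarrow> bool" where
  "doubly c \<longleftrightarrow> \<not> terminates c \<and> \<not> terminates (mirror M c)"

lemma \<alpha>_digits: "\<alpha> \<in> digits M"
  using \<alpha>_quasi by (simp add: quasi_def)

lemma const_value_gt_1: "1 < real M / (q - 1)"
  using q_gt_1 q_less by (simp add: field_simps)

lemma \<alpha>_not_const: "\<alpha> \<noteq> (\<lambda>_. M)"
  using val_\<alpha> val_const[OF q_gt_1, of M] const_value_gt_1 by auto

lemma \<alpha>_nonzero: "\<alpha> \<noteq> (\<lambda>_. 0)"
  using val_\<alpha> by (auto simp: val_def)

lemma lex_le_\<alpha>:
  assumes "d \<in> digits M" "val q d \<le> 1" "\<not> terminates d"
  shows "d \<sqsubseteq> \<alpha>"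
proof (rule ccontr)
  assume "\<not> ?thesis"
  then have "\<alpha> \<sqsubset> d" by auto
  from quasi_less[OF \<alpha>_quasi assms(1) q_gt_1 this] val_\<alpha> assms show False by simp
qed

lemma lex_less_\<alpha>:
  assumes "d \<in> digits M" "val q d < 1"
  shows "d \<sqsubset> \<alpha>"
proof (rule ccontr)
  assume "\<not> ?thesis"
  then have "\<alpha> \<sqsubset> d \<or> d = \<alpha>" using lex.neq_iff by blast
  then show False using quasi_less(1)[OF \<alpha>_quasi assms(1) q_gt_1] val_\<alpha> assms(2) by auto
qed

lemma quasi_tail_lex_le:
  assumes "quasi M q c" "\<not> terminates c" "c n < M"
  shows "tail (Suc n) c \<sqsubseteq> \<alpha>"
proof (rule lex_le_\<alpha>)
  show "tail (Suc n) c \<in> digits M" "val q (tail (Suc n) c) \<le> 1" using assms(1,3)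
    by (simp_all add: quasi_def)
  show "\<not> terminates (tail (Suc n) c)" using assms(2) terminates_tail by blast
qed

lemma tail_\<alpha>: "tail n \<alpha> \<sqsubseteq> \<alpha>"
  by (rule tail_lex_le[OF \<alpha>_digits]) (blast intro: quasi_tail_lex_le[OF \<alpha>_quasi \<alpha>_infinite], simp)

text \<open>Value conditions become order conditions. A value below 1 always puts a tail below
  \<open>\<alpha>\<close>; the converse needs the bounds on all later tails, through
  \<open>lex_le_imp_val\<close>.\<close>

lemma U_seqs_iff:
  assumes "c \<in> digits M"
  shows "c \<in> U_seqs \<longleftrightarrow> (\<forall>d\<in>digits M. val q d = val q c \<longrightarrow> d = c)"
proof -
  have q_le: "q \<le> real M + 1" using q_less by simp
  have "c \<in> U_seqs \<longleftrightarrow> (\<forall>n. (c n < M \<longrightarrow> val q (tail (Suc n) c) < 1) \<and>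
         (0 < c n \<longrightarrow> val q (mirror M (tail (Suc n) c)) < 1))"
  proof
    assume c: "c \<in> U_seqs"
    have "val q (tail (Suc n) c) < 1" if "c n < M" for n
      using lex_le_imp_val(2)[OF q_gt_1 \<alpha>_digits val_\<alpha> \<alpha>_infinite assms, of "Suc n"] c that
      by (auto simp: U_seqs_def lex.less_imp_le)
    moreover have "val q (mirror M (tail (Suc n) c)) < 1" if "0 < c n" for n
      using lex_le_imp_val(2)[OF q_gt_1 \<alpha>_digits val_\<alpha> \<alpha>_infinite mirror_digits[of M c], of "Suc n"]
        c that assms
      by (auto simp: U_seqs_def lex.less_imp_le mirror_tail mirror_apply)
    ultimately show "\<forall>n. (c n < M \<longrightarrow> val q (tail (Suc n) c) < 1) \<and>
         (0 < c n \<longrightarrow> val q (mirror M (tail (Suc n) c)) < 1)" by blast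
  qed (use assms in \<open>auto simp: U_seqs_def intro: lex_less_\<alpha>\<close>)
  then show ?thesis using unique_expansion_iff[OF q_gt_1 q_le assms] by blast
qed

lemma mirror_V_seqs:
  assumes "c \<in> V_seqs"
  shows "mirror M c \<in> V_seqs"
proof -
  have c: "c \<in> digits M" using assms by (simp add: V_seqs_def)
  have "0 < c n" if "mirror M c n < M" for n using that by (cases "c n") (auto simp: mirror_apply)
  moreover have "c n < M" if "0 < mirror M c n" for n using that by (simp add: mirror_apply)
  ultimately show ?thesis using assms c by (simp add: V_seqs_def mirror_tail)
qed

lemma mirror_U_seqs:
  assumes "c \<in> U_seqs"
  shows "mirror M c \<in> U_seqs"
proof -
  have c: "c \<in> digits M" using assms by (simp add: U_seqs_def)
  have "0 < c n" if "mirror M c n < M" for n using that by (cases "c n") (auto simp: mirror_apply)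
  moreover have "c n < M" if "0 < mirror M c n" for n using that by (simp add: mirror_apply)
  ultimately show ?thesis using assms c by (simp add: U_seqs_def mirror_tail)
qed

lemma U_seqs_subset_V_seqs: "U_seqs \<subseteq> V_seqs"
  by (auto simp: U_seqs_def V_seqs_def lex_le_def)

text \<open>After a last nonzero digit the reflected tail would be M^inf, which exceeds
  \<open>\<alpha>\<close>.\<close>

lemma V_seqs_not_terminates:
  assumes "c \<in> V_seqs"
  shows "\<not> terminates c"
proof
  assume "terminates c"
  then obtain n where n: "c n \<noteq> 0" "\<forall>i>n. c i = 0" by (auto simp: terminates_def)
  have "mirror M (tail (Suc n) c) = (\<lambda>_. M)" using n(2) by (auto simp: mirror_apply tail_apply)
  then have "(\<lambda>_. M) \<sqsubseteq> \<alpha>" using assms n(1) by (auto simp: V_seqs_def dest!: spec[of _ n])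
  with \<alpha>_not_const lex_le_const[OF \<alpha>_digits] show False by (metis lex.order_antisym)
qed

lemma V_seqs_doubly: "c \<in> V_seqs \<Longrightarrow> doubly c"
  using V_seqs_not_terminates mirror_V_seqs by (auto simp: doubly_def)

lemma V_seqs_quasi:
  assumes "c \<in> V_seqs"
  shows "quasi M q c"
proof -
  have c: "c \<in> digits M" "\<And>n. c n < M \<Longrightarrow> tail (Suc n) c \<sqsubseteq> \<alpha>" using assms by (auto simp: V_seqs_def)
  show ?thesis unfolding quasi_def
    using lex_le_imp_val(1)[OF q_gt_1 \<alpha>_digits val_\<alpha> \<alpha>_infinite c] c by blast
qed

text \<open>Both \<open>c\<close> and its reflection satisfy \<open>quasi\<close>. A different
  expansion is larger than \<open>c\<close>, or its reflection is larger than that of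
  \<open>c\<close>; in each case equality of values makes the larger sequence end in zeros.\<close>

lemma V_seqs_unique:
  assumes "c \<in> V_seqs" "d \<in> digits M" "val q d = val q c" "doubly d"
  shows "d = c"
proof (rule ccontr)
  assume "d \<noteq> c"
  have c: "c \<in> digits M" using assms(1) by (simp add: V_seqs_def)
  consider "c \<sqsubset> d" | "mirror M c \<sqsubset> mirror M d"
    using \<open>d \<noteq> c\<close> lex.neq_iff mirror_less_mirror[OF c assms(2)] by blast
  then show False
  proof cases
    case 1
    from quasi_less(2)[OF V_seqs_quasi[OF assms(1)] assms(2) q_gt_1 1] assms(3,4) show False
      by (simp add: doubly_def)
  next
    case 2
    from quasi_less(2)[OF V_seqs_quasi[OF mirror_V_seqs[OF assms(1)]] mirror_digits q_gt_1 2] assms c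
    show False by (simp add: doubly_def val_mirror q_gt_1)
  qed
qed

text \<open>For \<open>q < M + 1\<close> a quasi-greedy expansion cannot end in \<open>M\<^sup>\<infinity>\<close> after a smaller digit, since
  the value \<open>M / (q - 1)\<close> of \<open>M\<^sup>\<infinity>\<close> exceeds \<open>1\<close>.\<close>

lemma ex_quasi_doubly:
  assumes "0 \<le> x" "x \<le> real M / (q - 1)"
  obtains c where "quasi M q c" "val q c = x" "doubly c"
proof (cases "x = 0")
  case True
  have "quasi M q (\<lambda>_. 0)" by (simp add: quasi_def digits_def val_def tail_def)
  moreover have "doubly (\<lambda>_. 0)" using less_add_one
    by (fastforce simp: doubly_def terminates_def mirror_apply)
  moreover have "val q (\<lambda>_. 0) = x" using True by (simp add: val_def)
  ultimately show ?thesis using that by blast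
next
  case False
  then obtain c where c: "quasi M q c" "val q c = x" "\<not> terminates c"
    using ex_quasi_expansion[of q M x] assms q_gt_1 q_less by auto
  have dig: "c \<in> digits M" using c(1) by (simp add: quasi_def)
  have "\<not> terminates (mirror M c)"
  proof
    assume "terminates (mirror M c)"
    then obtain n where n: "M - c n \<noteq> 0" "\<forall>i>n. M - c i = 0"
      by (auto simp: terminates_def mirror_apply)
    then have "tail (Suc n) c = (\<lambda>_. M)"
      using digits_le[OF dig] by (intro ext) (simp add: tail_apply le_antisym)
    then have "val q (tail (Suc n) c) > 1" using val_const const_value_gt_1 q_gt_1 by simp
    moreover have "c n < M" using n(1) by simp
    ultimately show False using c(1) by (auto simp: quasi_def dest: spec[of _ n])
  qed
  with c that show ?thesis by (simp add: doubly_def)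
qed

text \<open>Uniqueness identifies \<open>c\<close> with the doubly infinite quasi-greedy expansion
  of its value, and \<open>mirror M c\<close> with that of the reflected value; each supplies one of
  the two bounds.\<close>

lemma V_seqs_if_unique:
  assumes "c \<in> digits M" "doubly c" "\<And>d. d \<in> digits M \<Longrightarrow> val q d = val q c \<Longrightarrow> doubly d \<Longrightarrow> d = c"
  shows "c \<in> V_seqs"
proof -
  obtain g where "quasi M q g" "val q g = val q c" "doubly g"
    using ex_quasi_doubly val_nonneg val_le assms(1) q_gt_1 by metis
  with assms have g: "quasi M q c" by (metis quasi_def)
  obtain h where h: "quasi M q h" "val q h = val q (mirror M c)" "doubly h"
    using ex_quasi_doubly val_nonneg val_le mirror_digits q_gt_1 by metis
  have hd: "h \<in> digits M" using h(1) by (simp add: quasi_def)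
  have "mirror M h = c"
    using assms(1,3) h hd by (auto simp: doubly_def val_mirror q_gt_1)
  then have "h = mirror M c" using hd by auto
  have "mirror M (tail (Suc n) c) \<sqsubseteq> \<alpha>" if "0 < c n" for n
    using quasi_tail_lex_le[of "mirror M c" n] h(1) that digits_le[OF assms(1), of n] assms(2)
    by (auto simp: \<open>h = mirror M c\<close> doubly_def mirror_apply mirror_tail)
  then show ?thesis
    using assms(1,2) quasi_tail_lex_le[OF g] by (simp add: V_seqs_def doubly_def)
qed

lemma \<alpha>_doubly: "doubly \<alpha>"
proof -
  obtain c where c: "quasi M q c" "val q c = 1" "doubly c"
    using ex_quasi_doubly const_value_gt_1 by (metis less_imp_le zero_le_one)
  then have "c = \<alpha>"
    using lex_le_\<alpha>[of c] quasi_less(2)[OF c(1) \<alpha>_digits q_gt_1] val_\<alpha> \<alpha>_infinite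
    by (auto simp: quasi_def doubly_def lex_le_def)
  with c show ?thesis by simp
qed

lemma digit_le_\<alpha>_0: "\<alpha> n \<le> \<alpha> 0"
proof (rule ccontr)
  assume "\<not> ?thesis"
  then have "\<alpha> \<sqsubset> tail n \<alpha>" by (auto simp: less_fun_def tail_apply intro!: exI[of _ 0])
  with tail_\<alpha> show False by (simp add: lex.leD)
qed

lemma \<alpha>_0_pos: "0 < \<alpha> 0"
proof (rule gr0I)
  assume "\<alpha> 0 = 0"
  then have "\<alpha> n = 0" for n using digit_le_\<alpha>_0[of n] by simp
  then show False using \<alpha>_nonzero by auto
qed

text \<open>Membership in \<open>V_seqs\<close> bounds reflected tails only after positive digits.
  Once the bound is known for \<open>mirror M \<alpha>\<close> itself, \<open>tail_lex_le\<close>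
  removes this restriction.\<close>

lemma mirror_tail_\<alpha>:
  assumes "\<alpha> \<in> V_seqs"
  shows "mirror M (tail n \<alpha>) \<sqsubseteq> \<alpha>"
proof -
  have step: "mirror M (tail (Suc n) \<alpha>) \<sqsubseteq> \<alpha>" if "0 < \<alpha> n" for n
    using assms that by (simp add: V_seqs_def)
  have "mirror M \<alpha> \<sqsubseteq> \<alpha>"
  proof (rule ccontr)
    assume "\<not> ?thesis"
    \<comment> \<open>Reflected back, this says that the first shift of \<open>\<alpha>\<close>
      exceeds \<open>\<alpha>\<close>.\<close>
    then have "mirror M (tail 1 \<alpha>) \<sqsubset> mirror M \<alpha>"
      using step[OF \<alpha>_0_pos] by (simp add: lex.not_le lex.le_less_trans)
    then show False using tail_\<alpha> \<alpha>_digits by (simp add: mirror_less_mirror lex.leD)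
  qed
  moreover have "tail (Suc n) (mirror M \<alpha>) \<sqsubseteq> \<alpha>" if "mirror M \<alpha> n < M" for n
    using step[of n] that by (cases "\<alpha> n") (simp_all add: mirror_tail mirror_apply)
  ultimately have "tail n (mirror M \<alpha>) \<sqsubseteq> \<alpha>"
    by (blast intro: tail_lex_le[OF mirror_digits])
  then show ?thesis by (simp add: mirror_tail)
qed

end

section \<open>Approximation by bases in which 1 has a unique expansion\<close>

text \<open>A strict comparison settled within the first \<open>n\<close> digits; it therefore
  survives the passage to the limit of longer and longer words.\<close>

definition word_less :: "nat \<Rightarrow> (nat \<Rightarrow> nat) \<Rightarrow> (nat \<Rightarrow> nat) \<Rightarrow> bool" where
  "word_less n c d \<longleftrightarrow> (\<exists>j<n. c j < d j \<and> (\<forall>l<j. c l = d l))"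

lemma word_less_imp_lex_less: "word_less n c d \<Longrightarrow> c \<sqsubset> d"
  by (auto simp: word_less_def less_fun_def)

lemma lex_less_imp_word_less: "c \<sqsubset> d \<Longrightarrow> \<not> (\<forall>j<n. c j = d j) \<Longrightarrow> word_less n c d"
  unfolding word_less_def less_fun_def by (metis less_trans linorder_neqE_nat)

lemma word_less_cong:
  assumes "word_less n c d" "n \<le> n'" "\<And>i. i < n \<Longrightarrow> c' i = c i" "\<And>i. i < n \<Longrightarrow> d' i = d i"
  shows "word_less n' c' d'"
  using assms unfolding word_less_def by (metis less_trans order_less_le_trans)

text \<open>The bounds are asymmetric on purpose: reflected suffixes must be strictly smaller than
  the prefix of their length, while suffixes may coincide with it. This is the form that doubling
  preserves.\<close>

definition admissible :: "nat \<Rightarrow> nat \<Rightarrow> (nat \<Rightarrow> nat) \<Rightarrow> bool" where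
  "admissible M m u \<longleftrightarrow> 0 < m \<and> (\<forall>i<m. u i \<le> M) \<and>
    (\<forall>i<m. word_less (m - i) (\<lambda>j. M - u (i + j)) u) \<and>
    (\<forall>i<m. (\<forall>j<m - i. u (i + j) = u j) \<or> word_less (m - i) (\<lambda>j. u (i + j)) u)"

text \<open>Only the first \<open>m\<close> values of \<open>u\<close> and the first \<open>2 * m\<close> values of \<open>double M m u\<close> are meaningful:
  the word \<open>u\<close> becomes \<open>u v\<^sup>+\<close>, where \<open>v\<close> is its reflection.\<close>

definition double :: "nat \<Rightarrow> nat \<Rightarrow> (nat \<Rightarrow> nat) \<Rightarrow> nat \<Rightarrow> nat" where
  "double M m u =
    (\<lambda>i. if i < m then u i else if Suc i < 2 * m then M - u (i - m) else Suc (M - u (m - 1)))"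

text \<open>In the second half reflection interchanges the two conditions on \<open>u\<close>; the
  added 1 makes a possible equality strict on one side and is absorbed by strictness on the other.
  The first conclusion is kept apart because it excludes equality, which is what makes the limit of
  iterated doubling strictly larger than its proper tails.\<close>

lemma double_admissible:
  assumes "admissible M m u"
  shows "\<And>i. 0 < i \<Longrightarrow> i < m \<Longrightarrow> word_less (2 * m - i) (\<lambda>j. double M m u (i + j)) (double M m u)"
    and "admissible M (2 * m) (double M m u)"
proof -
  let ?v = "double M m u"
  have m: "0 < m" and le: "\<And>i. i < m \<Longrightarrow> u i \<le> M"
    and low: "\<And>i. i < m \<Longrightarrow> word_less (m - i) (\<lambda>j. M - u (i + j)) u"
    and up: "\<And>i. i < m \<Longrightarrow> (\<forall>j<m - i. u (i + j) = u j) \<or> word_less (m - i) (\<lambda>j. u (i + j)) u"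
    using assms by (auto simp: admissible_def)
  have v1: "?v i = u i" if "i < m" for i using that by (simp add: double_def)
  have v2: "?v (m + i) = M - u i" if "Suc i < m" for i using that by (simp add: double_def)
  have v3: "?v (m + (m - 1)) = Suc (M - u (m - 1))" using m by (cases m) (auto simp: double_def)
  \<comment> \<open>Ensures that the raised final digit \<open>Suc (M - u (m - 1))\<close> stays in
    the alphabet.\<close>
  have last_pos: "0 < u (m - 1)"
  proof -
    have "M - u (m - 1) < u 0" using low[of "m - 1"] m by (simp add: word_less_def)
    then show ?thesis using le[of 0] m by linarith
  qed
  have v_le: "?v i \<le> M" if "i < 2 * m" for i
    using le[of i] le[of "m - 1"] last_pos m by (auto simp: double_def)
  have low1: "word_less (2 * m - i) (\<lambda>j. M - ?v (i + j)) ?v" if "i < m" for i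
    by (rule word_less_cong[OF low[OF that]]) (use v1 that in auto)
  \<comment> \<open>Reflecting the second half returns \<open>u\<close> with its last digit lowered
    by one, so the weak upper bound on suffixes of \<open>u\<close> turns into a strict one.\<close>
  have low2: "word_less (2 * m - (m + i)) (\<lambda>j. M - ?v (m + i + j)) ?v" if i: "i < m" for i
  proof -
    let ?l = "m - Suc i"
    have l: "M - ?v (m + i + ?l) = u (m - 1) - 1"
      using v3 i le[of "m - 1"] last_pos m by simp
    have l': "u (i + ?l) = u (m - 1)" using i by simp
    have w: "M - ?v (m + i + j) = u (i + j)" if "j < ?l" for j
      using v2[of "i + j"] that le[of "i + j"] by (simp add: add.assoc)
    from up[OF i] show ?thesis
    proof
      assume eq: "\<forall>j<m - i. u (i + j) = u j"
      then have "u (m - 1) = u ?l" using l' i by (metis Suc_diff_Suc lessI)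
      then show ?thesis unfolding word_less_def
        using l w eq v1 i last_pos by (intro exI[of _ ?l]) auto
    next
      assume "word_less (m - i) (\<lambda>j. u (i + j)) u"
      then obtain j where j: "j < m - i" "u (i + j) < u j" "\<forall>l<j. u (i + l) = u l"
        by (auto simp: word_less_def)
      have "M - ?v (m + i + j) \<le> u (i + j)"
        using w[of j] l l' j(1) by (cases "j = ?l") auto
      then show ?thesis unfolding word_less_def
        using j w v1 i by (intro exI[of _ j]) auto
    qed
  qed
  have up1: "word_less (2 * m - i) (\<lambda>j. ?v (i + j)) ?v" if i: "0 < i" "i < m" for i
    using up[OF i(2)]
  proof
    assume eq: "\<forall>j<m - i. u (i + j) = u j"
    \<comment> \<open>The suffix of \<open>u\<close> from \<open>i\<close> is also a prefix, so the
      comparison goes on between the reflection of \<open>u\<close> and the last \<open>i\<close>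
      digits of \<open>u\<close>; the lower condition at \<open>m - i\<close> decides it after
      reflection.\<close>
    have "word_less i (\<lambda>j. M - u (m - i + j)) u" using low[of "m - i"] i by simp
    then obtain j where j: "j < i" "M - u (m - i + j) < u j" "\<forall>l<j. M - u (m - i + l) = u l"
      by (auto simp: word_less_def)
    let ?j = "m - i + j"
    have a: "?v (i + (m - i + l)) = M - u l" if "l \<le> j" for l
      using v2[of l] that j(1) i by (simp add: add.assoc[symmetric])
    have b: "?v (m - i + l) = u (m - i + l)" if "l \<le> j" for l
      using v1[of "m - i + l"] that j(1) i by simp
    have "?v (i + ?j) < ?v ?j" using a[of j] b[of j] j(2) le[of ?j] le[of j] j(1) i by simp
    moreover have "?v (i + l) = ?v l" if "l < ?j" for l
    proof (cases "l < m - i")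
      case True
      then show ?thesis using eq v1[of l] v1[of "i + l"] by simp
    next
      case False
      define p where "p = l - (m - i)"
      have p: "l = m - i + p" "p < j" using False that by (auto simp: p_def)
      have "M - u (m - i + p) = u p" using j(3) p(2) by blast
      moreover have "u (m - i + p) \<le> M" using p(2) j(1) i by (intro le) simp
      ultimately have "M - u p = u (m - i + p)" by linarith
      then show ?thesis using a[of p] b[of p] p by simp
    qed
    ultimately show ?thesis unfolding word_less_def using j(1) i by (intro exI[of _ ?j]) auto
  next
    assume "word_less (m - i) (\<lambda>j. u (i + j)) u"
    then show ?thesis by (rule word_less_cong) (use v1 i in auto)
  qed
  have up2: "(\<forall>j<2 * m - (m + i). ?v (m + i + j) = ?v j) \<or>
      word_less (2 * m - (m + i)) (\<lambda>j. ?v (m + i + j)) ?v" if i: "i < m" for i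
  proof -
    let ?l = "m - Suc i"
    have l: "?v (m + i + ?l) = Suc (M - u (m - 1))" using v3 i m by simp
    have l': "u (i + ?l) = u (m - 1)" using i by simp
    have w: "?v (m + i + j) = M - u (i + j)" if "j < ?l" for j
      using v2[of "i + j"] that by (simp add: add.assoc)
    obtain j where j: "j < m - i" "M - u (i + j) < u j" "\<forall>l<j. M - u (i + l) = u l"
      using low[OF i] by (auto simp: word_less_def)
    have pre: "?v (m + i + k) = ?v k" if "k < j" for k
      using w[of k] j(1,3) v1[of k] that i by simp
    \<comment> \<open>The added 1 can cancel the strict difference only if that difference sits at
      the final digit, and then the whole words agree.\<close>
    have "?v (m + i + j) < ?v j \<or> (j = ?l \<and> ?v (m + i + j) = ?v j)"
      using w[of j] l l' j(1,2) v1[of j] i by (cases "j = ?l") auto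
    then show ?thesis
    proof (elim disjE conjE)
      assume "?v (m + i + j) < ?v j"
      then show ?thesis unfolding word_less_def using pre j(1) i by (intro disjI2 exI[of _ j]) auto
    next
      assume "j = ?l" "?v (m + i + j) = ?v j"
      then show ?thesis using pre i by (metis Suc_diff_Suc less_Suc_eq mult_2 add_diff_cancel_left)
    qed
  qed
  show "\<And>i. 0 < i \<Longrightarrow> i < m \<Longrightarrow> word_less (2 * m - i) (\<lambda>j. ?v (i + j)) ?v" by (rule up1)
  have split: "P i" if "\<And>i. i < m \<Longrightarrow> P i" "\<And>i. i < m \<Longrightarrow> P (m + i)" "i < 2 * m" for P i
    using that(1)[of i] that(2)[of "i - m"] that(3) by (cases "i < m") auto
  have "\<forall>i<2 * m. word_less (2 * m - i) (\<lambda>j. M - ?v (i + j)) ?v"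
    using split[of "\<lambda>i. word_less (2 * m - i) (\<lambda>j. M - ?v (i + j)) ?v"] low1 low2 by blast
  moreover have "\<forall>i<2 * m. (\<forall>j<2 * m - i. ?v (i + j) = ?v j) \<or>
      word_less (2 * m - i) (\<lambda>j. ?v (i + j)) ?v"
  proof (intro allI impI)
    have "(\<forall>j<2 * m - i. ?v (i + j) = ?v j) \<or> word_less (2 * m - i) (\<lambda>j. ?v (i + j)) ?v"
      if "i < m" for i using up1[of i] that by (cases "i = 0") auto
    then show "(\<forall>j<2 * m - i. ?v (i + j) = ?v j) \<or> word_less (2 * m - i) (\<lambda>j. ?v (i + j)) ?v"
      if "i < 2 * m" for i
      using split[of "\<lambda>i. (\<forall>j<2 * m - i. ?v (i + j) = ?v j) \<or>
          word_less (2 * m - i) (\<lambda>j. ?v (i + j)) ?v" i] up2 that by blast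
  qed
  ultimately show "admissible M (2 * m) ?v" unfolding admissible_def using m v_le by auto
qed

text \<open>The witness is the generalized Thue--Morse sequence, the limit of iterated doubling of \<open>u\<close>.\<close>

lemma admissible_extend:
  assumes "admissible M m u"
  obtains \<beta> where "\<beta> \<in> digits M" "\<forall>i<m. \<beta> i = u i"
    "\<And>n. 0 < n \<Longrightarrow> tail n \<beta> \<sqsubset> \<beta>" "\<And>n. mirror M (tail n \<beta>) \<sqsubset> \<beta>"
proof -
  define w where "w = rec_nat u (\<lambda>j. double M (2 ^ j * m))"
  have w0: "w 0 = u" and wSuc: "w (Suc j) = double M (2 ^ j * m) (w j)" for j
    by (simp_all add: w_def)
  have adm: "admissible M (2 ^ j * m) (w j)" for j
    using assms double_admissible(2) by (induction j) (auto simp: w0 wSuc mult.assoc)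
  have m: "0 < m" using assms by (simp add: admissible_def)
  have stable: "w (j + d) i = w j i" if "i < 2 ^ j * m" for i j d
  proof (induction d)
    case (Suc d)
    have "2 ^ j * m \<le> 2 ^ (j + d) * m" by simp
    then have "i < 2 ^ (j + d) * m" using that by linarith
    then show ?case using Suc by (simp add: wSuc double_def)
  qed simp
  have bound: "n < 2 ^ n * m" for n
  proof -
    have "n * 1 < 2 ^ n * m" using m by (intro mult_less_le_imp_less) auto
    then show ?thesis by simp
  qed
  define \<beta> where "\<beta> i = w i i" for i
  have \<beta>: "\<beta> i = w j i" if "i < 2 ^ j * m" for i j
    using stable[OF that, of "i - j"] stable[OF bound, of i "j - i"] unfolding \<beta>_def
    by (cases "j \<le> i") auto
  show ?thesis
  proof
    show "\<beta> \<in> digits M" using adm bound by (auto simp: digits_def \<beta>_def admissible_def)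
    show "\<forall>i<m. \<beta> i = u i" using \<beta>[of _ 0] by (simp add: w0)
    show "tail n \<beta> \<sqsubset> \<beta>" if n: "0 < n" for n
    proof -
      have "word_less (2 * (2 ^ n * m) - n) (\<lambda>j. w (Suc n) (n + j)) (w (Suc n))"
        unfolding wSuc by (rule double_admissible(1)[OF adm n bound])
      then have "word_less (2 * (2 ^ n * m) - n) (tail n \<beta>) \<beta>"
        by (rule word_less_cong) (auto simp: tail_apply mult.assoc intro!: \<beta>)
      then show ?thesis by (rule word_less_imp_lex_less)
    qed
    show "mirror M (tail n \<beta>) \<sqsubset> \<beta>" for n
    proof -
      have "word_less (2 ^ n * m - n) (\<lambda>j. M - w n (n + j)) (w n)"
        using adm[of n] bound[of n] by (simp add: admissible_def)
      then have "word_less (2 ^ n * m - n) (mirror M (tail n \<beta>)) \<beta>"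
        by (rule word_less_cong) (auto simp: tail_apply mirror_apply intro!: \<beta> arg_cong[where f = "\<lambda>x. M - x"])
      then show ?thesis by (rule word_less_imp_lex_less)
    qed
  qed
qed

text \<open>If a prefix of length \<open>N\<close> is not admissible, take the least \<open>i\<close> such that the reflection of
  the digits from position \<open>i\<close> to \<open>N\<close> starts \<open>\<alpha>\<close>; the prefix ending where this coincidence
  breaks off is admissible.\<close>

lemma ex_admissible_prefix:
  assumes \<alpha>: "\<alpha> \<in> digits M" and up: "\<And>n. tail n \<alpha> \<sqsubseteq> \<alpha>" and low: "\<And>n. mirror M (tail n \<alpha>) \<sqsubset> \<alpha>"
    and "0 < N"
  shows "\<exists>m\<ge>N. admissible M m \<alpha>"
proof -
  define matched where "matched i m \<longleftrightarrow> i < m \<and> (\<forall>j<m - i. M - \<alpha> (i + j) = \<alpha> j)" for i m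
  have adm: "admissible M m \<alpha>" if "0 < m" "\<And>i. \<not> matched i m" for m
    unfolding admissible_def
  proof (intro conjI allI impI)
    show "\<alpha> i \<le> M" for i using \<alpha> by (rule digits_le)
    show "word_less (m - i) (\<lambda>j. M - \<alpha> (i + j)) \<alpha>" if "i < m" for i
      using lex_less_imp_word_less[of "\<lambda>j. M - \<alpha> (i + j)" \<alpha> "m - i"] low[of i]
        \<open>\<not> matched i m\<close> that by (auto simp: matched_def tail_def mirror_def)
    show "(\<forall>j<m - i. \<alpha> (i + j) = \<alpha> j) \<or> word_less (m - i) (\<lambda>j. \<alpha> (i + j)) \<alpha>" for i
      using lex_less_imp_word_less[of "tail i \<alpha>" \<alpha> "m - i"] up[of i]
      by (auto simp: lex_le_def tail_def fun_eq_iff)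
  qed (rule that(1))
  show ?thesis
  proof (cases "\<exists>i. matched i N")
    case False
    then show ?thesis using adm assms(4) by blast
  next
    case True
    define i where "i = (LEAST i. matched i N)"
    have i: "matched i N" unfolding i_def using True by (rule LeastI_ex)
    obtain j where j: "M - \<alpha> (i + j) < \<alpha> j" "\<And>l. l < j \<Longrightarrow> M - \<alpha> (i + l) = \<alpha> l"
      using low[of i] by (auto simp: less_fun_def mirror_apply tail_apply)
    have "N \<le> i + j"
    proof (rule ccontr)
      assume "\<not> ?thesis"
      then have "M - \<alpha> (i + j) = \<alpha> j" using i by (auto simp: matched_def)
      with j(1) show False by simp
    qed
    have "\<not> matched i' (Suc (i + j))" for i'
    proof
      assume i': "matched i' (Suc (i + j))"
      consider "i' < i" | "i' = i" | "i < i'" by linarith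
      then show False
      proof cases
        case 1
        then have "matched i' N" using i i' \<open>N \<le> i + j\<close> by (auto simp: matched_def)
        then show False using 1 not_less_Least unfolding i_def by blast
      next
        case 2
        then show False using i' j(1) by (auto simp: matched_def)
      next
        case 3
        \<comment> \<open>The two matches overlap: on the overlap \<open>\<alpha>\<close> agrees
          with its shift by \<open>p\<close>, and where the match at \<open>i\<close> breaks off the
          shift is larger.\<close>
        define p where "p = i' - i"
        have p: "i' = i + p" "p \<le> j" using 3 i' by (auto simp: p_def matched_def)
        have m: "M - \<alpha> (i + (p + l)) = \<alpha> l" if "l \<le> j - p" for l
          using i' p that by (auto simp: matched_def add.assoc)
        have "\<alpha> (p + l) = \<alpha> l" if "l < j - p" for l
          using m[of l] j(2)[of "p + l"] that by simp
        moreover have "\<alpha> (j - p) < \<alpha> (p + (j - p))"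
          using m[of "j - p"] j(1) p(2) by simp
        ultimately have "\<alpha> \<sqsubset> tail p \<alpha>"
          by (auto simp: less_fun_def tail_apply intro!: exI[of _ "j - p"])
        then show False using up by (simp add: lex.leD)
      qed
    qed
    then show ?thesis using adm[of "Suc (i + j)"] \<open>N \<le> i + j\<close> by (meson le_SucI zero_less_Suc)
  qed
qed

section \<open>Values as functions of the base\<close>

lemma val_strict_antimono:
  assumes "c \<in> digits M" "c \<noteq> (\<lambda>_. 0)" "1 < r" "r < s"
  shows "val s c < val r c"
proof -
  \<comment> \<open>Each term shrinks at least by the factor \<open>r / s\<close>, since every
    exponent is at least 1.\<close>
  have "val s c \<le> r / s * val r c"
  proof (rule sums_le)
    show "(\<lambda>i. real (c i) / s ^ Suc i) sums val s c" using val_sums assms by simp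
    show "(\<lambda>i. r / s * (real (c i) / r ^ Suc i)) sums (r / s * val r c)"
      using val_sums assms by (intro sums_mult) simp
    show "real (c i) / s ^ Suc i \<le> r / s * (real (c i) / r ^ Suc i)" for i
    proof -
      have "real (c i) / s / s ^ i \<le> real (c i) / s / r ^ i"
        using assms by (intro divide_left_mono power_mono) auto
      then show ?thesis using assms by simp
    qed
  qed
  moreover have "0 < val r c"
    using val_nonneg[OF assms(1,3)] val_eq_0_iff[OF assms(1,3)] assms(2) by linarith
  then have "r / s * val r c < 1 * val r c"
    using assms by (intro mult_strict_right_mono) auto
  ultimately show ?thesis by simp
qed

lemma continuous_on_val:
  assumes "c \<in> digits M" "1 < a"
  shows "continuous_on {a..b} (\<lambda>r. val r c)"
proof -
  have summ: "summable (\<lambda>i. real (c i) * (1 / r) ^ i)" if "1 < r" for r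
  proof -
    have "summable (\<lambda>i. r * (real (c i) / r ^ Suc i))"
      using val_sums[OF assms(1) that] by (intro summable_mult) (rule sums_summable)
    then show ?thesis using that by (simp add: power_divide)
  qed
  have "continuous_on {a..b} (\<lambda>r. (\<Sum>i. real (c i) * (1 / r) ^ i) * (1 / r))"
  proof (intro continuous_on_mult continuous_on_divide continuous_on_const continuous_on_id ballI)
    have "isCont (\<lambda>r. \<Sum>i. real (c i) * (1 / r) ^ i) r" if "r \<in> {a..b}" for r
    proof -
      have r: "1 < r" using that assms(2) by simp
      then have inv: "isCont (\<lambda>r. 1 / r) r" by (intro continuous_intros) auto
      \<comment> \<open>A point between \<open>1 / r\<close> and 1 at which the power series in the
        reciprocal of the base still converges.\<close>
      define K where "K = 1 / ((1 + r) / 2)"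
      have "isCont (\<lambda>x. \<Sum>i. real (c i) * x ^ i) (1 / r)"
      proof (rule isCont_powser)
        show "summable (\<lambda>i. real (c i) * K ^ i)" unfolding K_def using r by (intro summ) simp
        show "norm (1 / r) < norm K" unfolding K_def using r by (simp add: field_simps)
      qed
      then show ?thesis by (rule isCont_o2[OF inv])
    qed
    then show "continuous_on {a..b} (\<lambda>r. \<Sum>i. real (c i) * (1 / r) ^ i)"
      by (intro continuous_at_imp_continuous_on) blast
  qed (use assms in auto)
  moreover have "(\<Sum>i. real (c i) * (1 / r) ^ i) * (1 / r) = val r c" if "r \<in> {a..b}" for r
  proof -
    have "1 < r" using that assms(2) by simp
    then have "(\<Sum>i. real (c i) * (1 / r) ^ i) * (1 / r) = (\<Sum>i. real (c i) * (1 / r) ^ i * (1 / r))"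
      by (intro suminf_mult2 summ)
    then show ?thesis by (simp add: val_def power_divide mult.commute)
  qed
  ultimately show ?thesis by (rule continuous_on_eq)
qed

text \<open>In a base where \<open>\<beta>\<close> has value 1 it serves as its own bound:
  \<open>lex_le_imp_val\<close> with \<open>\<beta>\<close> in the role of \<open>\<gamma>\<close>
  turns the domination of tails and reflected tails into the remainder criterion for
  uniqueness.\<close>

lemma self_dominating_unique:
  assumes "\<beta> \<in> digits M" "\<And>n. tail (Suc n) \<beta> \<sqsubset> \<beta>" "\<And>n. mirror M (tail (Suc n) \<beta>) \<sqsubset> \<beta>"
    and "1 < r" "r \<le> real M + 1" "val r \<beta> = 1" "d \<in> digits M" "val r d = 1"
  shows "d = \<beta>"
proof -
  have inf: "\<not> terminates \<beta>"
  proof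
    assume "terminates \<beta>"
    then obtain n where "\<forall>i>n. \<beta> i = 0" by (auto simp: terminates_def)
    then have "mirror M (tail (Suc n) \<beta>) = (\<lambda>_. M)" by (auto simp: mirror_apply tail_apply)
    then show False using assms(3)[of n] lex_le_const[OF assms(1)] by (simp add: lex.leD)
  qed
  have "val r (tail (Suc n) \<beta>) < 1" for n
    by (rule lex_le_imp_val(2)[OF assms(4,1,6) inf assms(1)]) (use assms(2) in \<open>auto simp: lex_le_def\<close>)
  moreover have "val r (tail (Suc n) (mirror M \<beta>)) < 1" for n
    by (rule lex_le_imp_val(2)[OF assms(4,1,6) inf mirror_digits])
      (use assms(3) in \<open>auto simp: lex_le_def mirror_tail[symmetric]\<close>)
  ultimately show ?thesis
    using unique_expansion_iff[OF assms(4,5,1)] assms(6-8) by (simp add: mirror_tail)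
qed

context quasi_greedy_base
begin

text \<open>The value of \<open>\<alpha>\<close> exceeds 1 slightly to the left of \<open>q\<close>
  and is below 1 slightly to the right. A sequence with a long enough common prefix keeps both
  inequalities weakly, and the intermediate value theorem yields the base.\<close>

lemma base_of_close_sequence:
  assumes "0 < e"
  obtains m where "\<And>\<beta>. \<beta> \<in> digits M \<Longrightarrow> \<forall>i<m. \<beta> i = \<alpha> i \<Longrightarrow>
    \<exists>r. 1 < r \<and> r \<le> real M + 1 \<and> \<bar>r - q\<bar> \<le> e \<and> val r \<beta> = 1"
proof -
  define \<delta> where "\<delta> = min e (min ((q - 1) / 2) ((real M + 1 - q) / 2))"
  have \<delta>: "0 < \<delta>" "\<delta> \<le> e" "1 < q - \<delta>" "q + \<delta> \<le> real M + 1"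
    using assms q_gt_1 q_less unfolding \<delta>_def by (auto simp: min_def field_simps)
  define gap where "gap = min (val (q - \<delta>) \<alpha> - 1) (1 - val (q + \<delta>) \<alpha>)"
  have "1 < val (q - \<delta>) \<alpha>" "val (q + \<delta>) \<alpha> < 1"
    using val_strict_antimono[OF \<alpha>_digits \<alpha>_nonzero, of "q - \<delta>" q]
      val_strict_antimono[OF \<alpha>_digits \<alpha>_nonzero, of q "q + \<delta>"] \<delta> q_gt_1 val_\<alpha> by auto
  then have "0 < gap" by (simp add: gap_def)
  have "(\<lambda>m. M / (q - \<delta> - 1) * (1 / (q - \<delta>)) ^ m) \<longlonglongrightarrow> 0"
    using \<delta> by (intro tendsto_mult_right_zero LIMSEQ_power_zero) auto
  then have "\<forall>\<^sub>F m in sequentially. M / (q - \<delta> - 1) * (1 / (q - \<delta>)) ^ m < gap"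
    using \<open>0 < gap\<close> by (rule order_tendstoD)
  then obtain m where m: "M / (q - \<delta> - 1) * (1 / (q - \<delta>)) ^ m < gap"
    by (auto simp: eventually_sequentially)
  show ?thesis
  proof
    fix \<beta> assume \<beta>: "\<beta> \<in> digits M" "\<forall>i<m. \<beta> i = \<alpha> i"
    have near: "\<bar>val r \<alpha> - val r \<beta>\<bar> < gap" if "q - \<delta> \<le> r" for r
    proof -
      have "\<bar>val r \<alpha> - val r \<beta>\<bar> \<le> M / (r - 1) / r ^ m"
        using val_agree[OF \<beta>(1) \<alpha>_digits _ \<beta>(2), of r] \<delta>(3) that by simp
      \<comment> \<open>The error bound decreases in the base, so its value at the left end serves
        the whole interval.\<close>
      also have "\<dots> \<le> M / (q - \<delta> - 1) / (q - \<delta>) ^ m"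
        using that \<delta>(3) by (intro frac_le power_mono) auto
      finally show ?thesis using m by (simp add: power_divide)
    qed
    have "val (q + \<delta>) \<beta> \<le> 1" "1 \<le> val (q - \<delta>) \<beta>"
      using near[of "q + \<delta>"] near[of "q - \<delta>"] \<delta>(1) by (auto simp: gap_def abs_less_iff)
    then obtain r where "q - \<delta> \<le> r" "r \<le> q + \<delta>" "val r \<beta> = 1"
      using IVT2'[of "\<lambda>r. val r \<beta>" "q + \<delta>" 1 "q - \<delta>"] continuous_on_val[OF \<beta>(1) \<delta>(3)] \<delta>(1)
      by auto
    then show "\<exists>r. 1 < r \<and> r \<le> real M + 1 \<and> \<bar>r - q\<bar> \<le> e \<and> val r \<beta> = 1"
      using \<delta> by (intro exI[of _ r]) auto
  qed
qed

lemma ex_unique_base_near: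
  assumes "\<alpha> \<in> V_seqs" "\<And>n. 0 < n \<Longrightarrow> mirror M (tail n \<alpha>) \<noteq> \<alpha>" "0 < e"
  obtains r \<beta> where "1 < r" "\<bar>r - q\<bar> \<le> e" "\<beta> \<in> digits M" "val r \<beta> = 1"
    "\<And>d. d \<in> digits M \<Longrightarrow> val r d = 1 \<Longrightarrow> d = \<beta>"
proof -
  have pos: "mirror M (tail n \<alpha>) \<sqsubset> \<alpha>" if "0 < n" for n
    using mirror_tail_\<alpha>[OF assms(1), of n] assms(2)[OF that] by (simp add: lex_le_def)
  \<comment> \<open>The hypothesis covers only positive shifts; a self-reflected
    \<open>\<alpha>\<close> would be exceeded by its own first shift.\<close>
  have "mirror M \<alpha> \<noteq> \<alpha>"
  proof
    assume "mirror M \<alpha> = \<alpha>"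
    then have "mirror M (tail 1 \<alpha>) \<sqsubset> mirror M \<alpha>" using pos[of 1] by simp
    then show False using tail_\<alpha> \<alpha>_digits by (simp add: mirror_less_mirror lex.leD)
  qed
  then have low: "mirror M (tail n \<alpha>) \<sqsubset> \<alpha>" for n
    using pos mirror_tail_\<alpha>[OF assms(1), of 0] by (cases "n = 0") (auto simp: lex_le_def)
  obtain m where m: "\<And>\<beta>. \<beta> \<in> digits M \<Longrightarrow> \<forall>i<m. \<beta> i = \<alpha> i \<Longrightarrow>
    \<exists>r. 1 < r \<and> r \<le> real M + 1 \<and> \<bar>r - q\<bar> \<le> e \<and> val r \<beta> = 1"
    using base_of_close_sequence[OF assms(3)] by blast
  obtain N where N: "N \<ge> Suc m" "admissible M N \<alpha>"
    using ex_admissible_prefix[OF \<alpha>_digits tail_\<alpha> low, of "Suc m"] by blast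
  obtain \<beta> where \<beta>: "\<beta> \<in> digits M" "\<forall>i<N. \<beta> i = \<alpha> i"
    "\<And>n. 0 < n \<Longrightarrow> tail n \<beta> \<sqsubset> \<beta>" "\<And>n. mirror M (tail n \<beta>) \<sqsubset> \<beta>"
    using admissible_extend[OF N(2)] by blast
  obtain r where r: "1 < r" "r \<le> real M + 1" "\<bar>r - q\<bar> \<le> e" "val r \<beta> = 1"
    using m[OF \<beta>(1)] \<beta>(2) N(1) by auto
  show ?thesis
    using that[OF r(1,3) \<beta>(1) r(4)] self_dominating_unique[OF \<beta>(1) _ \<beta>(4) r(1,2,4)] \<beta>(3) by blast
qed

end

section \<open>Topology and cardinality of sets of sequences\<close>

lemma open_cylinder: "open {d :: nat \<Rightarrow> nat. \<forall>i<N. d i = c i}"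
proof -
  have "open ((\<lambda>d :: nat \<Rightarrow> nat. d i) -` {c i})" for i
    by (rule open_vimage[OF open_discrete]) (rule continuous_on_product_coordinates)
  then have "open (\<Inter>i\<in>{..<N}. (\<lambda>d :: nat \<Rightarrow> nat. d i) -` {c i})" by blast
  also have "(\<Inter>i\<in>{..<N}. (\<lambda>d :: nat \<Rightarrow> nat. d i) -` {c i}) = {d. \<forall>i<N. d i = c i}" by auto
  finally show ?thesis .
qed

lemma closed_seqsI:
  fixes S :: "(nat \<Rightarrow> nat) set"
  assumes "\<And>c. c \<notin> S \<Longrightarrow> \<exists>N. \<forall>d. (\<forall>i<N. d i = c i) \<longrightarrow> d \<notin> S"
  shows "closed S"
proof -
  have "\<exists>T. open T \<and> c \<in> T \<and> T \<subseteq> - S" if "c \<in> - S" for c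
  proof -
    from that have "c \<notin> S" by simp
    from assms[OF this] obtain N where N: "\<forall>d. (\<forall>i<N. d i = c i) \<longrightarrow> d \<notin> S" ..
    have "{d. \<forall>i<N. d i = c i} \<subseteq> - S" using N by blast
    then show ?thesis using open_cylinder[of N c] by blast
  qed
  then show ?thesis unfolding closed_def using open_subopen[of "- S"] by blast
qed

lemma compact_digits: "compact (digits M)"
proof -
  have "digits M = PiE UNIV (\<lambda>_. {..M})" by (auto simp: digits_def)
  moreover have "compactin (product_topology (\<lambda>_. euclidean) UNIV) (PiE UNIV (\<lambda>_::nat. {..M}))"
    unfolding compactin_PiE by (simp add: finite_imp_compact)
  ultimately show ?thesis by (simp add: euclidean_product_topology)
qed

lemma continuous_on_digits_val:
  assumes "1 < q"
  shows "continuous_on (digits M) (val q)"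
  unfolding continuous_on_topological
proof (intro ballI allI impI)
  fix c B assume c: "c \<in> digits M" and B: "open B" "val q c \<in> B"
  obtain e where e: "0 < e" "ball (val q c) e \<subseteq> B" using B by (auto simp: open_contains_ball)
  have "(\<lambda>N. M / (q - 1) * (1 / q) ^ N) \<longlonglongrightarrow> 0"
    using assms by (intro tendsto_mult_right_zero LIMSEQ_power_zero) auto
  then have "\<forall>\<^sub>F N in sequentially. M / (q - 1) * (1 / q) ^ N < e" using e(1)
    by (rule order_tendstoD)
  then obtain N where N: "M / (q - 1) / q ^ N < e"
    by (auto simp: eventually_sequentially power_divide)
  have "val q d \<in> B" if "d \<in> digits M" "\<forall>i<N. d i = c i" for d
  proof -
    have "\<bar>val q c - val q d\<bar> < e" using val_agree[OF that(1) c assms that(2)] N by linarith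
    then show ?thesis using e(2) by (auto simp: dist_real_def)
  qed
  then show "\<exists>A. open A \<and> c \<in> A \<and> (\<forall>y\<in>digits M. y \<in> A \<longrightarrow> val q y \<in> B)"
    using open_cylinder[of N c] by (intro exI[of _ "{d. \<forall>i<N. d i = c i}"]) auto
qed

lemma closed_val_image:
  assumes "1 < q" "closed S" "S \<subseteq> digits M"
  shows "closed (val q ` S)"
proof -
  have "compact S" using compact_Int_closed[OF compact_digits assms(2), of M] assms(3)
    by (simp add: Int_absorb1)
  then show ?thesis
    using compact_continuous_image continuous_on_subset[OF continuous_on_digits_val[OF assms(1)] assms(3)]
      compact_imp_closed by blast
qed

lemma countable_same_tail: "countable {c :: nat \<Rightarrow> nat. \<exists>n. tail n c = \<gamma>}"
proof -
  have "inj_on (\<lambda>c. map c [0..<n]) {c. tail n c = \<gamma>}" for n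
    by (rule inj_onI) (auto intro: agree_eqI[of n])
  then have "countable {c. tail n c = \<gamma>}" for n by (rule countableI')
  then have "countable (\<Union>n. {c. tail n c = \<gamma>})" by blast
  then show ?thesis by (simp add: Collect_ex_eq)
qed

lemma terminates_tail_zero: "terminates c \<Longrightarrow> \<exists>n. tail n c = (\<lambda>_. 0)"
  unfolding terminates_def tail_def by (metis add_Suc less_add_Suc1)

lemma terminates_mirror_tail:
  assumes "c \<in> digits M" "terminates (mirror M c)"
  shows "\<exists>n. tail n c = (\<lambda>_. M)"
proof -
  obtain n where "tail n (mirror M c) = (\<lambda>_. 0)" using terminates_tail_zero[OF assms(2)] by blast
  then have "mirror M (tail n (mirror M c)) = (\<lambda>_. M)" by (simp add: mirror_def)
  then show ?thesis using assms(1) by (auto simp: mirror_tail)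
qed

section \<open>Replacing a tail\<close>

text \<open>The new expansions all arise in this way: the digit at position \<open>p\<close> becomes
  \<open>a\<close>, and the tail \<open>y\<close> starts at \<open>Suc p\<close>. The value is kept
  when digit plus value of the tail is unchanged.\<close>

definition graft :: "(nat \<Rightarrow> nat) \<Rightarrow> nat \<Rightarrow> nat \<Rightarrow> (nat \<Rightarrow> nat) \<Rightarrow> nat \<Rightarrow> nat" where
  "graft c p a y = (\<lambda>i. if i < p then c i else if i = p then a else y (i - Suc p))"

lemma tail_graft [simp]: "tail (Suc p) (graft c p a y) = y"
  by (auto simp: graft_def tail_def)

lemma graft_digits: "c \<in> digits M \<Longrightarrow> y \<in> digits M \<Longrightarrow> a \<le> M \<Longrightarrow> graft c p a y \<in> digits M"
  by (simp add: digits_def graft_def)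

lemma val_graft:
  assumes "c \<in> digits M" "y \<in> digits M" "a \<le> M" "1 < q"
    and "real a + val q y = real (c p) + val q (tail (Suc p) c)"
  shows "val q (graft c p a y) = val q c"
proof -
  have "q ^ Suc p * (val q (graft c p a y) - val q c) =
      real (graft c p a y p) - real (c p) + val q (tail (Suc p) (graft c p a y)) - val q (tail (Suc p) c)"
    by (rule val_compare[OF assms(1) graft_digits[OF assms(1-3)] assms(4)]) (simp add: graft_def)
  also have "graft c p a y p = a" by (simp add: graft_def)
  finally have "q ^ Suc p * (val q (graft c p a y) - val q c) = 0" using assms(5) by simp
  then show ?thesis using assms(4) by simp
qed

lemma val_zero [simp]: "val q (\<lambda>_. 0) = 0"
  by (simp add: val_def)

lemma zero_digits [simp]: "(\<lambda>_. 0) \<in> digits M"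
  by (simp add: digits_def)

section \<open>Bases whose quasi-greedy expansion of 1 runs into its own reflection\<close>

locale self_mirror_base = quasi_greedy_base +
  fixes k :: nat
  assumes \<alpha>_V: "\<alpha> \<in> V_seqs" and k_pos: "0 < k" and tail_k: "tail k \<alpha> = mirror M \<alpha>"
begin

lemma tail_2k: "tail (2 * k) \<alpha> = \<alpha>"
proof -
  have "tail (2 * k) \<alpha> = tail k (tail k \<alpha>)" by (simp add: mult_2)
  also have "\<dots> = mirror M (tail k \<alpha>)" by (simp only: tail_k mirror_tail[symmetric])
  finally show ?thesis using \<alpha>_digits by (simp add: tail_k)
qed

text \<open>If the last digit of the block were 0, its reflection \<open>M\<close> followed by
  \<open>\<alpha>\<close> would be at most \<open>\<alpha>\<close>. Then \<open>\<alpha>\<close>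
  starts with \<open>M\<close> and is at most its own first shift, hence equal to it, and so it
  would be M^inf.\<close>

lemma \<alpha>_last_pos: "0 < \<alpha> (k - 1)"
proof (rule gr0I)
  assume 0: "\<alpha> (k - 1) = 0"
  have le: "mirror M (tail (k - 1) \<alpha>) \<sqsubseteq> \<alpha>" by (rule mirror_tail_\<alpha>[OF \<alpha>_V])
  have "\<alpha> 0 = M"
  proof (rule ccontr)
    assume "\<alpha> 0 \<noteq> M"
    then have "\<alpha> 0 < M" using digits_le[OF \<alpha>_digits, of 0] by simp
    then have "\<alpha> \<sqsubset> mirror M (tail (k - 1) \<alpha>)"
      using 0 by (auto simp: less_fun_def mirror_apply tail_apply intro!: exI[of _ 0])
    with le show False by (simp add: lex.leD)
  qed
  with 0 have "\<forall>i<1. mirror M (tail (k - 1) \<alpha>) i = \<alpha> i" by (simp add: mirror_apply tail_apply)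
  then have "tail 1 (mirror M (tail (k - 1) \<alpha>)) \<sqsubseteq> tail 1 \<alpha>" using le lex_le_agree by blast
  moreover have "tail 1 (mirror M (tail (k - 1) \<alpha>)) = \<alpha>"
    using k_pos \<alpha>_digits by (simp add: mirror_tail[symmetric] tail_k)
  ultimately have eq: "tail 1 \<alpha> = \<alpha>" using tail_\<alpha>[of 1] by (simp add: lex.order_antisym)
  have "\<alpha> (Suc n) = \<alpha> n" for n using eq by (metis tail_apply plus_1_eq_Suc)
  then have "\<alpha> n = M" for n using \<open>\<alpha> 0 = M\<close> by (induction n) auto
  then show False using \<alpha>_not_const by auto
qed

lemma mirror_\<alpha>_last_less: "M - \<alpha> (k - 1) < M"
  using \<alpha>_last_pos digits_le[OF \<alpha>_digits, of "k - 1"] by simp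

text \<open>After the first \<open>k\<close> digits of \<open>\<alpha>\<close> the upper bound forces the rest to be at most the reflection
  of \<open>\<alpha>\<close>, and the lower bound, active because \<open>\<alpha> (k - 1) > 0\<close>, forces it to be at least that.\<close>

lemma V_seqs_prefix:
  assumes "c \<in> V_seqs" "c n < M" "\<forall>i<k. c (Suc n + i) = \<alpha> i"
  shows "tail (Suc n) c = \<alpha>"
proof -
  have c: "c \<in> digits M" using assms(1) by (simp add: V_seqs_def)
  have agree: "\<forall>i<k. tail (Suc n) c i = \<alpha> i" using assms(3) by (simp add: tail_apply)
  have "tail (Suc n) c \<sqsubseteq> \<alpha>" using assms(1,2) by (simp add: V_seqs_def)
  then have "tail k (tail (Suc n) c) \<sqsubseteq> mirror M \<alpha>" using lex_le_agree[OF agree] tail_k by simp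
  moreover have "mirror M \<alpha> \<sqsubseteq> tail k (tail (Suc n) c)"
  proof -
    have "0 < c (n + k)" using assms(3)[rule_format, of "k - 1"] \<alpha>_last_pos k_pos by simp
    then have "mirror M (tail (Suc (n + k)) c) \<sqsubseteq> \<alpha>" using assms(1) by (simp add: V_seqs_def)
    then show ?thesis using c \<alpha>_digits by (simp add: mirror_le_iff)
  qed
  ultimately have "tail k (tail (Suc n) c) = tail k \<alpha>" using tail_k by (simp add: lex.order_antisym)
  with agree show ?thesis by (rule agree_eqI)
qed

lemma V_seqs_mirror_prefix:
  assumes "c \<in> V_seqs" "0 < c n" "\<forall>i<k. c (Suc n + i) = M - \<alpha> i"
  shows "mirror M (tail (Suc n) c) = \<alpha>"
proof -
  have c: "c \<in> digits M" using assms(1) by (simp add: V_seqs_def)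
  have "mirror M c n < M" using assms(2) digits_le[OF c, of n] by (simp add: mirror_apply)
  moreover have "\<forall>i<k. mirror M c (Suc n + i) = \<alpha> i"
    using assms(3) digits_le[OF \<alpha>_digits] by (simp add: mirror_apply)
  ultimately show ?thesis
    using V_seqs_prefix[OF mirror_V_seqs[OF assms(1)]] by (simp add: mirror_tail)
qed

text \<open>Weak and strict bounds differ only when a tail or its reflection equals
  \<open>\<alpha>\<close>, and within \<open>V_seqs\<close> this is already visible on
  \<open>k\<close> digits.\<close>

lemma U_seqs_forbidden_words:
  "c \<in> U_seqs \<longleftrightarrow> c \<in> V_seqs \<and> (\<forall>n. \<not> (c n < M \<and> (\<forall>i<k. c (Suc n + i) = \<alpha> i)) \<and>
    \<not> (0 < c n \<and> (\<forall>i<k. c (Suc n + i) = M - \<alpha> i)))" (is "_ \<longleftrightarrow> ?rhs")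
proof
  assume c: "c \<in> U_seqs"
  then have "c \<in> V_seqs" using U_seqs_subset_V_seqs by blast
  moreover have "tail (Suc n) c \<noteq> \<alpha>" if "c n < M" for n using c that by (auto simp: U_seqs_def)
  moreover have "mirror M (tail (Suc n) c) \<noteq> \<alpha>" if "0 < c n" for n
    using c that by (auto simp: U_seqs_def)
  ultimately show ?rhs using V_seqs_prefix V_seqs_mirror_prefix by blast
next
  assume c: ?rhs
  have "tail (Suc n) c \<noteq> \<alpha>" if "c n < M" for n using c that by (auto simp: tail_def)
  moreover have "mirror M (tail (Suc n) c) \<noteq> \<alpha>" if "0 < c n" for n
  proof
    assume "mirror M (tail (Suc n) c) = \<alpha>"
    moreover have "c (Suc n + i) \<le> M" for i using c digits_le[of c M] by (simp add: V_seqs_def)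
    ultimately have "\<forall>i. c (Suc n + i) = M - \<alpha> i" by (auto simp: mirror_def tail_def)
    then show False using c that by blast
  qed
  ultimately show "c \<in> U_seqs" using c by (auto simp: U_seqs_def V_seqs_def lex_le_def)
qed

text \<open>Equality in the lower bound reduces to equality in the upper one: a tail
  \<open>mirror M \<alpha>\<close> is followed, \<open>k\<close> digits later, by
  \<open>\<alpha>\<close>, and the digit before that is \<open>M - \<alpha> (k - 1)\<close>, which
  is below \<open>M\<close>.\<close>

lemma V_minus_U_tail:
  assumes "c \<in> V_seqs - U_seqs"
  obtains n where "c n < M" "tail (Suc n) c = \<alpha>"
proof -
  have c: "c \<in> V_seqs" "c \<in> digits M" using assms by (auto simp: V_seqs_def)
  obtain n where "(c n < M \<and> tail (Suc n) c = \<alpha>) \<or> (0 < c n \<and> mirror M (tail (Suc n) c) = \<alpha>)"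
    using assms by (auto simp: U_seqs_def V_seqs_def lex_le_def)
  then show ?thesis
  proof (elim disjE conjE)
    assume "mirror M (tail (Suc n) c) = \<alpha>"
    then have t: "tail (Suc n) c = tail k \<alpha>" using c(2) tail_k by auto
    have "tail (Suc (n + k)) c = tail k (tail (Suc n) c)" by simp
    also have "\<dots> = \<alpha>" using tail_2k by (simp add: t mult_2)
    finally have "tail (Suc (n + k)) c = \<alpha>" .
    moreover have "c (n + k) = mirror M \<alpha> (k - 1)"
      using t tail_k k_pos by (metis Suc_pred' add_Suc_shift tail_apply plus_1_eq_Suc add.commute)
    then have "c (n + k) < M" using mirror_\<alpha>_last_less by (simp add: mirror_apply)
    ultimately show ?thesis using that by blast
  qed (use that in blast)
qed

section \<open>Closed sets of sequences and isolated points\<close>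

lemma closed_V_seqs: "closed V_seqs"
proof (rule closed_seqsI)
  fix c assume "c \<notin> V_seqs"
  then consider i where "M < c i" | n where "c n < M" "\<alpha> \<sqsubset> tail (Suc n) c"
    | n where "0 < c n" "\<alpha> \<sqsubset> mirror M (tail (Suc n) c)"
    unfolding V_seqs_def digits_def by (auto simp: not_le)
  then show "\<exists>N. \<forall>d. (\<forall>i<N. d i = c i) \<longrightarrow> d \<notin> V_seqs"
  proof cases
    case 1
    then have "d \<notin> V_seqs" if "\<forall>j<Suc i. d j = c j" for d
      using that digits_le[of d M i] by (auto simp: V_seqs_def)
    then show ?thesis by blast
  next
    case 2
    then obtain j where j: "\<alpha> j < c (Suc n + j)" "\<forall>i<j. \<alpha> i = c (Suc n + i)"
      by (auto simp: less_fun_def tail_apply)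
    have "d \<notin> V_seqs" if d: "\<forall>i<Suc n + Suc j. d i = c i" for d
    proof -
      have "\<alpha> \<sqsubset> tail (Suc n) d"
        unfolding less_fun_def using d j by (intro exI[of _ j]) (simp add: tail_apply)
      moreover have "d n < M" using d 2(1) by simp
      ultimately show ?thesis by (auto simp: V_seqs_def lex.not_le intro!: exI[of _ n])
    qed
    then show ?thesis by blast
  next
    case 3
    then obtain j where j: "\<alpha> j < M - c (Suc n + j)" "\<forall>i<j. \<alpha> i = M - c (Suc n + i)"
      by (auto simp: less_fun_def tail_apply mirror_apply)
    have "d \<notin> V_seqs" if d: "\<forall>i<Suc n + Suc j. d i = c i" for d
    proof -
      have "\<alpha> \<sqsubset> mirror M (tail (Suc n) d)"
        unfolding less_fun_def using d j by (intro exI[of _ j]) (simp add: tail_apply mirror_apply)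
      moreover have "0 < d n" using d 3(1) by simp
      ultimately show ?thesis by (auto simp: V_seqs_def lex.not_le intro!: exI[of _ n])
    qed
    then show ?thesis by blast
  qed
qed

lemma closed_U_seqs: "closed U_seqs"
proof -
  have "closed {c. \<forall>n. \<not> (c n < M \<and> (\<forall>i<k. c (Suc n + i) = \<alpha> i)) \<and>
    \<not> (0 < c n \<and> (\<forall>i<k. c (Suc n + i) = M - \<alpha> i))}" (is "closed ?S")
  proof (rule closed_seqsI)
    fix c assume "c \<notin> ?S"
    then obtain n where n: "(c n < M \<and> (\<forall>i<k. c (Suc n + i) = \<alpha> i)) \<or>
      (0 < c n \<and> (\<forall>i<k. c (Suc n + i) = M - \<alpha> i))" by blast
    have "d \<notin> ?S" if "\<forall>i<Suc n + k. d i = c i" for d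
    proof -
      have "d n = c n" "\<forall>i<k. d (Suc n + i) = c (Suc n + i)" using that by auto
      with n show ?thesis by (auto intro!: exI[of _ n])
    qed
    then show "\<exists>N. \<forall>d. (\<forall>i<N. d i = c i) \<longrightarrow> d \<notin> ?S" by blast
  qed
  moreover have "U_seqs = V_seqs \<inter> ?S" using U_seqs_forbidden_words by blast
  ultimately show ?thesis using closed_V_seqs by (simp add: closed_Int)
qed

text \<open>The prefix of \<open>c\<close> that ends with a forced block of length \<open>k\<close>
  determines \<open>c\<close> within \<open>V_seqs\<close>; removing \<open>c\<close> thus removes a
  whole cylinder.\<close>

lemma closed_V_seqs_remove:
  assumes "c \<in> V_seqs - U_seqs"
  shows "closed (V_seqs - {c})"
proof -
  obtain n where n: "c n < M" "tail (Suc n) c = \<alpha>" using V_minus_U_tail[OF assms] .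
  have "d = c" if d: "d \<in> V_seqs" "\<forall>i<Suc n + k. d i = c i" for d
  proof -
    have "d n < M" using d(2) n(1) by simp
    moreover have "\<forall>i<k. d (Suc n + i) = \<alpha> i" using d(2) n(2) by (auto simp: tail_def)
    ultimately have t: "tail (Suc n) d = \<alpha>" using V_seqs_prefix d(1) by blast
    show ?thesis by (rule agree_eqI[of "Suc n"]) (use d(2) n(2) t in auto)
  qed
  then have "V_seqs - {c} = V_seqs \<inter> - {d. \<forall>i<Suc n + k. d i = c i}" by blast
  then show ?thesis using closed_V_seqs open_cylinder[of "Suc n + k" c]
    by (simp add: closed_Int closed_Compl)
qed

text \<open>Cut \<open>c\<close> at the first possible place \<open>m\<close> such that the digits between \<open>m\<close> and \<open>n\<close> agree
  with \<open>\<alpha>\<close>, and continue with \<open>\<alpha>\<close>: minimality of \<open>m\<close> ensures that no block starting earlier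
  becomes too large.\<close>

lemma U_seqs_branch:
  assumes c: "c \<in> U_seqs" and n: "c n < M"
  obtains m d where "m \<le> n" "n < m + k" "d \<in> V_seqs - U_seqs" "\<forall>i\<le>m. d i = c i"
proof -
  have cV: "c \<in> V_seqs" and dig: "c \<in> digits M" using c U_seqs_subset_V_seqs
    by (auto simp: U_seqs_def)
  define P where "P j \<longleftrightarrow> j \<le> n \<and> c j < M \<and> (\<forall>i<n - j. c (Suc j + i) = \<alpha> i)" for j
  define m where "m = (LEAST j. P j)"
  have Pm: "P m" unfolding m_def by (rule LeastI[of P n]) (simp add: P_def n)
  have min: "\<not> P j" if "j < m" for j using that not_less_Least unfolding m_def by blast
  have m: "m \<le> n" "c m < M" using Pm by (auto simp: P_def)
  have short: "n < m + k"
  proof (rule ccontr)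
    assume "\<not> ?thesis"
    then have "\<forall>i<k. c (Suc m + i) = \<alpha> i" using Pm by (auto simp: P_def)
    then show False using c m(2) U_seqs_forbidden_words by blast
  qed
  have no_block: "\<not> (\<forall>i<m - j. tail (Suc j) c i = \<alpha> i)" if j: "j < m" "c j < M" for j
  proof
    assume agree: "\<forall>i<m - j. tail (Suc j) c i = \<alpha> i"
    have "tail (Suc j) c \<sqsubseteq> \<alpha>" using cV j(2) by (simp add: V_seqs_def)
    then have "tail (m - j) (tail (Suc j) c) \<sqsubseteq> tail (m - j) \<alpha>" using lex_le_agree[OF agree] by simp
    then have "tail (Suc m) c \<sqsubseteq> tail (m - j) \<alpha>" using j(1) by simp
    moreover have "\<forall>i<n - m. tail (Suc m) c i = \<alpha> i" using Pm by (simp add: P_def tail_apply)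
    \<comment> \<open>The shifted \<open>\<alpha>\<close> lies between the tail of \<open>c\<close>,
      which agrees with \<open>\<alpha>\<close> on these digits, and \<open>\<alpha>\<close>
      itself.\<close>
    ultimately have sq: "\<forall>i<n - m. tail (m - j) \<alpha> i = \<alpha> i" using tail_\<alpha> lex_squeeze by blast
    have "c (Suc j + i) = \<alpha> i" if "i < n - j" for i
    proof (cases "i < m - j")
      case True
      then show ?thesis using agree by (simp add: tail_apply)
    next
      case False
      define l where "l = i - (m - j)"
      have l: "i = (m - j) + l" "l < n - m" using False that j(1) m(1) by (auto simp: l_def)
      have "c (Suc m + l) = \<alpha> l" using Pm l(2) by (simp add: P_def)
      moreover have "\<alpha> (m - j + l) = \<alpha> l" using sq l(2) by (simp add: tail_apply)
      moreover have "Suc j + i = Suc m + l" using l(1) j(1) by simp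
      ultimately show ?thesis using l(1) by simp
    qed
    then have "P j" using j m(1) by (simp add: P_def)
    then show False using min j(1) by blast
  qed
  define d where "d = graft c m (c m) \<alpha>"
  have d_eq: "d i = c i" if "i \<le> m" for i using that by (auto simp: d_def graft_def)
  have d_tail: "tail (Suc m) d = \<alpha>" by (simp add: d_def)
  have d_dig: "d \<in> digits M" unfolding d_def using dig \<alpha>_digits m(2) by (intro graft_digits) auto
  have agree: "\<forall>i<m - p. tail (Suc p) d i = tail (Suc p) c i" for p
    using d_eq by (simp add: tail_apply)
  have rest: "tail (m - p) (tail (Suc p) d) = \<alpha>" if "p \<le> m" for p using that d_tail by simp
  have "(d p < M \<longrightarrow> tail (Suc p) d \<sqsubseteq> \<alpha>) \<and> (0 < d p \<longrightarrow> mirror M (tail (Suc p) d) \<sqsubseteq> \<alpha>)" for p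
  proof (cases "p < m")
    case False
    then have "tail (Suc p) d = tail (p - m) (tail (Suc m) d)" by simp
    then have "tail (Suc p) d = tail (p - m) \<alpha>" using d_tail by simp
    then show ?thesis using tail_\<alpha> mirror_tail_\<alpha>[OF \<alpha>_V] by simp
  next
    case True
    have dp: "d p = c p" using d_eq True by simp
    have "tail (Suc p) d \<sqsubset> \<alpha>" if "c p < M"
    proof (rule lex_less_prefix_cong)
      show "tail (Suc p) c \<sqsubset> \<alpha>" using c that by (simp add: U_seqs_def)
      show "\<not> (\<forall>i<m - p. tail (Suc p) c i = \<alpha> i)" by (rule no_block[OF True that])
    qed (use agree in auto)
    moreover have "mirror M (tail (Suc p) d) \<sqsubseteq> \<alpha>" if "0 < c p"
    proof (cases "\<forall>i<m - p. mirror M (tail (Suc p) c) i = \<alpha> i")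
      case eq: True
      then have "\<forall>i<m - p. mirror M (tail (Suc p) d) i = \<alpha> i" using agree
        by (simp add: mirror_apply)
      \<comment> \<open>Beyond the cut \<open>mirror M \<alpha>\<close> is compared with a tail of
        \<open>\<alpha>\<close>, which \<open>mirror_tail_\<alpha>\<close> settles after
        reflection.\<close>
      moreover have "tail (m - p) (mirror M (tail (Suc p) d)) \<sqsubseteq> tail (m - p) \<alpha>"
        using rest[of p] True mirror_tail_\<alpha>[OF \<alpha>_V, of "m - p"] \<alpha>_digits
        by (simp only: mirror_tail[symmetric] less_imp_le) (simp add: mirror_le_iff)
      ultimately show ?thesis using lex_le_agree by blast
    next
      case False
      have "mirror M (tail (Suc p) d) \<sqsubset> \<alpha>"
      proof (rule lex_less_prefix_cong[OF _ False])
        show "mirror M (tail (Suc p) c) \<sqsubset> \<alpha>" using c that by (simp add: U_seqs_def)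
      qed (use agree in \<open>auto simp: mirror_apply\<close>)
      then show ?thesis by simp
    qed
    ultimately show ?thesis using dp by (auto intro: lex.less_imp_le)
  qed
  then have "d \<in> V_seqs" using d_dig by (simp add: V_seqs_def)
  moreover have "d \<notin> U_seqs"
  proof
    assume "d \<in> U_seqs"
    moreover have "d m < M" using m(2) d_eq by simp
    ultimately have "tail (Suc m) d \<sqsubset> \<alpha>" by (simp add: U_seqs_def)
    then show False using d_tail by simp
  qed
  ultimately show ?thesis using that[OF m(1) short] d_eq by blast
qed

lemma V_seqs_approx:
  assumes "c \<in> V_seqs"
  obtains d where "d \<in> V_seqs - U_seqs" "\<forall>i<N. d i = c i"
proof (cases "c \<in> U_seqs")
  case True
  have dig: "c \<in> digits M" using True by (simp add: U_seqs_def)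
  \<comment> \<open>The cut lies less than \<open>k\<close> places before the chosen position, hence
    beyond \<open>N\<close>. Since \<open>M\<close> is positive, that digit is below
    \<open>M\<close> in \<open>c\<close> or in its reflection.\<close>
  let ?n = "N + k"
  have "0 < M" using \<alpha>_last_pos digits_le[OF \<alpha>_digits, of "k - 1"] by simp
  then have "c ?n < M \<or> mirror M c ?n < M" unfolding mirror_apply by arith
  then consider "c ?n < M" | "mirror M c ?n < M" by blast
  then show ?thesis
  proof cases
    case 1
    from U_seqs_branch[OF True 1] obtain m d where
      "?n < m + k" "d \<in> V_seqs - U_seqs" "\<forall>i\<le>m. d i = c i" by metis
    then show ?thesis using that[of d] by simp
  next
    case 2
    from U_seqs_branch[OF mirror_U_seqs[OF True] 2] obtain m d where
      md: "?n < m + k" "d \<in> V_seqs - U_seqs" "\<forall>i\<le>m. d i = mirror M c i" by metis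
    have d: "d \<in> digits M" using md(2) by (simp add: V_seqs_def)
    have "mirror M d \<in> V_seqs - U_seqs"
      using md(2) mirror_V_seqs[of d] mirror_U_seqs[of "mirror M d"] d by auto
    moreover have "\<forall>i<N. mirror M d i = c i" using md(1,3) digits_le[OF dig]
      by (simp add: mirror_apply)
    ultimately show ?thesis using that by blast
  qed
next
  case False
  then show ?thesis using that[of c] assms by simp
qed

section \<open>Density, discreteness and cardinality\<close>

lemma dense_values: "val q ` V_seqs \<subseteq> closure (val q ` (V_seqs - U_seqs))"
proof
  fix x assume "x \<in> val q ` V_seqs"
  then obtain c where c: "c \<in> V_seqs" "x = val q c" by blast
  have dig: "c \<in> digits M" using c(1) by (simp add: V_seqs_def)
  have "\<exists>N. M / (q - 1) / q ^ N < e" if "0 < e" for e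
  proof -
    have "(\<lambda>N. M / (q - 1) * (1 / q) ^ N) \<longlonglongrightarrow> 0"
      using q_gt_1 by (intro tendsto_mult_right_zero LIMSEQ_power_zero) auto
    then have "\<forall>\<^sub>F N in sequentially. M / (q - 1) * (1 / q) ^ N < e" using that
      by (rule order_tendstoD)
    then show ?thesis by (auto simp: eventually_sequentially power_divide)
  qed
  note small = this
  have "\<exists>y\<in>val q ` (V_seqs - U_seqs). dist y x < e" if "0 < e" for e
  proof -
    obtain N where N: "M / (q - 1) / q ^ N < e" using small[OF \<open>0 < e\<close>] by blast
    obtain d where d: "d \<in> V_seqs - U_seqs" "\<forall>i<N. d i = c i" using V_seqs_approx[OF c(1)] .
    have "\<bar>val q d - val q c\<bar> < e"
      using val_agree[OF dig _ q_gt_1, of d N] d N by (auto simp: V_seqs_def)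
    then show ?thesis using d(1) c(2) by (auto simp: dist_real_def)
  qed
  then show "x \<in> closure (val q ` (V_seqs - U_seqs))" by (simp add: closure_approachable)
qed

lemma inj_on_val_V_seqs: "inj_on (val q) V_seqs"
proof (rule inj_onI)
  fix c d assume "c \<in> V_seqs" "d \<in> V_seqs" "val q c = val q d"
  then show "c = d" using V_seqs_unique[of d c] V_seqs_doubly by (simp add: V_seqs_def)
qed

lemma discrete_values: "discrete (val q ` (V_seqs - U_seqs))"
proof (rule discreteI)
  fix x assume "x \<in> val q ` (V_seqs - U_seqs)"
  then obtain c where c: "c \<in> V_seqs - U_seqs" "x = val q c" by blast
  \<comment> \<open>By injectivity of \<open>val q\<close> on \<open>V_seqs\<close>, this open set
    meets the values of \<open>V_seqs\<close> only in \<open>x\<close>.\<close>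
  have "open (- (val q ` (V_seqs - {c})))"
    by (rule open_Compl, rule closed_val_image[OF q_gt_1 closed_V_seqs_remove[OF c(1)]]) (auto simp: V_seqs_def)
  moreover have "val q ` (V_seqs - {c}) = val q ` V_seqs - {x}"
    using inj_on_image_set_diff[OF inj_on_val_V_seqs, of V_seqs "{c}"] c by simp
  then have "- (val q ` (V_seqs - {c})) \<inter> val q ` (V_seqs - U_seqs) = {x}" using c by auto
  ultimately show "x isolated_in val q ` (V_seqs - U_seqs)"
    unfolding isolated_in_def using c by blast
qed

lemma zero_in_U_seqs: "(\<lambda>_. 0) \<in> U_seqs"
  using zero_lex_le[of \<alpha>] \<alpha>_nonzero by (auto simp: U_seqs_def tail_def lex_le_def)

text \<open>A finite set of values would be closed, so by density it would contain every value from
  \<open>V_seqs\<close>, including that of the zero sequence in \<open>U_seqs\<close>.\<close>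

lemma infinite_V_minus_U: "infinite (V_seqs - U_seqs)"
proof
  assume "finite (V_seqs - U_seqs)"
  then have "closed (val q ` (V_seqs - U_seqs))" by (intro finite_imp_closed finite_imageI)
  then have "val q ` V_seqs \<subseteq> val q ` (V_seqs - U_seqs)" using dense_values by simp
  then have "V_seqs \<subseteq> V_seqs - U_seqs"
    using inj_on_image_subset_iff[OF inj_on_val_V_seqs] by blast
  then show False using zero_in_U_seqs U_seqs_subset_V_seqs by blast
qed

lemma countable_V_minus_U: "countable (V_seqs - U_seqs)"
proof -
  have "V_seqs - U_seqs \<subseteq> {c. \<exists>n. tail n c = \<alpha>}" using V_minus_U_tail by blast
  then show ?thesis using countable_same_tail countable_subset by blast
qed

lemma countable_expansions:
  assumes "c \<in> V_seqs"
  shows "countable {d \<in> digits M. val q d = val q c}"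
proof -
  have "{d \<in> digits M. val q d = val q c} \<subseteq>
    {c} \<union> {d. \<exists>n. tail n d = (\<lambda>_. 0)} \<union> {d. \<exists>n. tail n d = (\<lambda>_. M)}"
    using V_seqs_unique[OF assms] terminates_tail_zero terminates_mirror_tail
    unfolding doubly_def by blast
  then show ?thesis using countable_same_tail
    by (meson countable_Un countable_empty countable_insert countable_subset)
qed

text \<open>\<open>\<alpha>\<close> has period \<open>2 * k\<close> and each period ends with a
  digit below \<open>M\<close>. Raising that digit by 1 pays for deleting the rest, which is again
  \<open>\<alpha>\<close> and has value 1.\<close>

lemma infinite_expansions_of_1: "infinite {d \<in> digits M. val q d = 1}"
proof -
  \<comment> \<open>The position, counted from 0, of the last digit of period number
    \<open>Suc j\<close>.\<close>
  define p where "p j = 2 * k * Suc j - 1" for j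
  have Suc_p: "Suc (p j) = 2 * k * Suc j" for j using k_pos by (simp add: p_def)
  have period: "tail (2 * k * j) \<alpha> = \<alpha>" for j
  proof (induction j)
    case (Suc j)
    have "tail (2 * k * Suc j) \<alpha> = tail (2 * k * j) (tail (2 * k) \<alpha>)" by (simp add: add.commute)
    then show ?case using Suc tail_2k by simp
  qed simp
  have less: "\<alpha> (p j) < M" for j
  proof -
    have "tail k (tail (2 * k * j) \<alpha>) (k - 1) = \<alpha> (p j)"
      using k_pos by (auto simp: tail_apply p_def intro!: arg_cong[where f = \<alpha>])
    then show ?thesis using mirror_\<alpha>_last_less
      by (simp add: period tail_k mirror_apply del: tail_tail)
  qed
  define g where "g j = graft \<alpha> (p j) (Suc (\<alpha> (p j))) (\<lambda>_. 0)" for j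
  have "g j \<in> digits M" for j
    unfolding g_def using \<alpha>_digits less[of j] by (intro graft_digits) auto
  moreover have "val q (g j) = 1" for j
    unfolding g_def using val_graft[OF \<alpha>_digits _ _ q_gt_1, of "\<lambda>_. 0" "Suc (\<alpha> (p j))" "p j"] less[of j]
    by (simp add: Suc_p period val_\<alpha> del: mult_Suc_right)
  moreover have "inj g"
  proof (rule linorder_injI)
    fix i j :: nat assume "i < j"
    then have "p i < p j" using Suc_p k_pos
      by (metis Suc_less_eq mult_less_cancel1 zero_less_numeral nat_0_less_mult_iff)
    then have "g i (p i) \<noteq> g j (p i)" by (simp add: g_def graft_def)
    then show "g i \<noteq> g j" by auto
  qed
  ultimately show ?thesis
    by (intro infinite_super[OF _ range_inj_infinite[OF \<open>inj g\<close>]]) auto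
qed

end

section \<open>Transfer to streams\<close>

definition of_seq :: "(nat \<Rightarrow> nat) \<Rightarrow> nat stream" where
  "of_seq c = smap c nats"

lemma snth_of_seq [simp]: "snth (of_seq c) = c"
  by (auto simp: of_seq_def)

lemma of_seq_snth [simp]: "of_seq (snth c) = c"
  by (simp add: of_seq_def stream_smap_nats[symmetric])

lemma snth_eq_iff: "snth c = snth d \<longleftrightarrow> c = (d :: nat stream)"
  by (metis of_seq_snth)

lemma snth_reflect [simp]: "snth (reflect M c) = mirror M (snth c)"
  by (auto simp: reflect_def mirror_def)

lemma snth_sdrop [simp]: "snth (sdrop n c) = tail n (snth c)"
  by (auto simp: sdrop_snth tail_def)

lemma snth_sconst [simp]: "snth (sconst a) = (\<lambda>_. a)"
  by auto

lemma snth_graft: "snth ((stake p b @ [a]) @- y) = graft (snth b) p a (snth y)"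
  by (auto simp: graft_def shift_snth nth_append fun_eq_iff simp del: shift_append)

lemma decr_last_stake: "decr_last (stake (Suc p) b) = stake p b @ [b !! p - 1]"
  by (simp only: decr_last_def stake_Suc) simp

lemma last_nonzero_at_Suc:
  "last_nonzero_at c (Suc p) \<longleftrightarrow> c !! p \<noteq> 0 \<and> (\<forall>i>p. c !! i = 0)"
proof -
  have "(\<forall>i>Suc p. c !! (i - 1) = 0) \<longleftrightarrow> (\<forall>i>p. c !! i = 0)"
    by (metis Suc_diff_1 Suc_less_eq diff_Suc_1 less_trans zero_less_Suc)
  then show ?thesis by (simp add: last_nonzero_at_def)
qed

lemma last_nonzero_atE:
  assumes "last_nonzero_at c n"
  obtains p where "n = Suc p" "c !! p \<noteq> 0" "\<forall>i>p. c !! i = 0"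
  using assms last_nonzero_at_Suc by (cases n) (auto simp: last_nonzero_at_def)

lemma finite_seq_iff: "finite_seq c \<longleftrightarrow> terminates (snth c)"
  unfolding finite_seq_def terminates_def by (metis last_nonzero_atE last_nonzero_at_Suc)

lemma doubly_infinite_iff:
  "doubly_infinite M c \<longleftrightarrow> quasi_greedy_base.doubly M (snth c)" if "quasi_greedy_base M q \<alpha>"
  using that by (simp add: doubly_infinite_def finite_seq_iff quasi_greedy_base.doubly_def)

lemma mem_expansions_iff:
  assumes "1 < q"
  shows "c \<in> expansions M q x \<longleftrightarrow> snth c \<in> digits M \<and> val q (snth c) = x"
proof -
  have "c \<in> streams {0..M} \<longleftrightarrow> snth c \<in> digits M" by (simp add: streams_iff_snth digits_def)
  then show ?thesis
    using val_sums[OF _ assms, of "snth c" M] by (auto simp: expansions_def dest: sums_unique2)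
qed

lemma expansions_eqpoll:
  assumes "1 < q"
  shows "expansions M q x \<approx> {d \<in> digits M. val q d = x}"
proof -
  have "bij_betw snth (expansions M q x) {d \<in> digits M. val q d = x}"
    by (rule bij_betw_byWitness[of _ of_seq]) (auto simp: mem_expansions_iff[OF assms])
  then show ?thesis by (auto simp: eqpoll_def)
qed

lemma countably_infinite_eqpoll: "countable A \<Longrightarrow> infinite A \<Longrightarrow> A \<approx> (UNIV :: nat set)"
  using to_nat_on_infinite eqpoll_def by blast

lemma lex_greatest_eqI:
  assumes "g \<in> S" "\<And>d. d \<in> S \<Longrightarrow> d \<noteq> g \<Longrightarrow> snth d \<sqsubset> snth g"
  shows "lex_greatest S = g"
  unfolding lex_greatest_def
proof (rule the_equality)
  fix c assume "c \<in> S \<and> (\<forall>d\<in>S. d \<noteq> c \<longrightarrow> snth d \<sqsubset> snth c)"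
  then show "c = g" using assms by (metis less_fun_asym)
qed (use assms in blast)

lemma greedy_greatest:
  assumes "1 < q" "q \<le> real M + 1" "0 \<le> x" "x \<le> real M / (q - 1)"
  shows "greedy M q x \<in> expansions M q x"
    and "d \<in> expansions M q x \<Longrightarrow> d \<noteq> greedy M q x \<Longrightarrow> snth d \<sqsubset> snth (greedy M q x)"
proof -
  obtain c where c: "c \<in> digits M" "val q c = x" "\<And>n. c n < M \<Longrightarrow> val q (tail (Suc n) c) < 1"
    using ex_greedy_expansion[OF assms] by blast
  have mem: "of_seq c \<in> expansions M q x" using c(1,2) by (simp add: mem_expansions_iff assms(1))
  have less: "snth d \<sqsubset> snth (of_seq c)" if d: "d \<in> expansions M q x" "d \<noteq> of_seq c" for d
  proof -
    have "\<not> c \<sqsubset> snth d"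
      using greedy_less[OF c(1,3) _ assms(1), of "snth d"] c(2) d(1)
      by (auto simp: mem_expansions_iff assms(1))
    moreover have "snth d \<noteq> c" using d(2) by auto
    ultimately show ?thesis using lex_less_linear by auto
  qed
  have eq: "greedy M q x = of_seq c" unfolding greedy_def using mem less by (rule lex_greatest_eqI)
  show "greedy M q x \<in> expansions M q x" using mem eq by simp
  show "d \<in> expansions M q x \<Longrightarrow> d \<noteq> greedy M q x \<Longrightarrow> snth d \<sqsubset> snth (greedy M q x)"
    using less eq by simp
qed

lemma snth_quasi_greedy:
  assumes "1 < q" "q \<le> real M + 1" "0 < x" "x \<le> real M / (q - 1)"
  shows "quasi M q (snth (quasi_greedy M q x))" "val q (snth (quasi_greedy M q x)) = x"
    "\<not> terminates (snth (quasi_greedy M q x))"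
proof -
  obtain c where c: "quasi M q c" "val q c = x" "\<not> terminates c"
    using ex_quasi_expansion[OF assms] by blast
  have "quasi_greedy M q x = of_seq c"
    unfolding quasi_greedy_def
  proof (rule lex_greatest_eqI)
    show "of_seq c \<in> {c \<in> expansions M q x. infinite_seq c}"
      using c by (simp add: mem_expansions_iff assms(1) finite_seq_iff quasi_def)
    show "snth d \<sqsubset> snth (of_seq c)"
      if d: "d \<in> {c \<in> expansions M q x. infinite_seq c}" "d \<noteq> of_seq c" for d
    proof -
      have "\<not> c \<sqsubset> snth d"
        using quasi_less(2)[OF c(1) _ assms(1), of "snth d"] c(2) d(1)
        by (auto simp: mem_expansions_iff assms(1) finite_seq_iff)
      moreover have "snth d \<noteq> c" using d(2) by auto
      ultimately show ?thesis using lex_less_linear by auto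
    qed
  qed
  then show "quasi M q (snth (quasi_greedy M q x))" "val q (snth (quasi_greedy M q x)) = x"
    "\<not> terminates (snth (quasi_greedy M q x))" using c by auto
qed

lemma top_base_unique:
  assumes "1 \<le> M"
  shows "real M + 1 \<in> unique_bases M"
proof -
  let ?q = "real M + 1"
  have q: "1 < ?q" using assms by simp
  have "c = sconst M" if "c \<in> expansions M ?q 1" for c
  proof -
    have c: "snth c \<in> digits M" "val ?q (snth c) = 1" using that unfolding mem_expansions_iff[OF q]
      by auto
    have "val ?q (mirror M (snth c)) = 0" using c assms q by (simp add: val_mirror)
    then have "mirror M (snth c) = (\<lambda>_. 0)" using val_eq_0_iff[OF mirror_digits q] by blast
    then have "snth c = mirror M (\<lambda>_. 0)" using c(1) by (metis mirror_mirror)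
    then have "snth c = snth (sconst M)" by (simp add: mirror_def)
    then show ?thesis by (simp only: snth_eq_iff)
  qed
  moreover have "sconst M \<in> expansions M ?q 1"
    unfolding mem_expansions_iff[OF q] using assms by (simp add: digits_def val_const)
  ultimately show ?thesis using q unfolding unique_bases_def by blast
qed

section \<open>The bases in V and the least of them for even M\<close>

lemma doubly_unique_base_le:
  assumes "q \<in> doubly_unique_bases M"
  shows "1 < q" "q \<le> real M + 1"
proof -
  show q: "1 < q" using assms by (simp add: doubly_unique_bases_def)
  obtain c where "c \<in> expansions M q 1" using assms by (auto simp: doubly_unique_bases_def)
  then have "1 \<le> real M / (q - 1)" using val_le[of "snth c" M q] q
    by (auto simp: mem_expansions_iff)
  then show "q \<le> real M + 1" using q by (simp add: field_simps)
qed

lemma doubly_unique_base: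
  assumes "q \<in> doubly_unique_bases M" "q \<noteq> real M + 1"
  shows "quasi_greedy_base M q (snth (quasi_greedy M q 1))"
    and "snth (quasi_greedy M q 1) \<in> quasi_greedy_base.V_seqs M (snth (quasi_greedy M q 1))"
proof -
  note q = doubly_unique_base_le[OF assms(1)]
  have "1 \<le> real M / (q - 1)" using q by (simp add: field_simps)
  note \<alpha> = snth_quasi_greedy[OF q zero_less_one this]
  show base: "quasi_greedy_base M q (snth (quasi_greedy M q 1))"
    using \<alpha> q assms(2) by unfold_locales auto
  interpret quasi_greedy_base M q "snth (quasi_greedy M q 1)" by (rule base)
  show "snth (quasi_greedy M q 1) \<in> V_seqs"
  proof (rule V_seqs_if_unique[OF \<alpha>_digits \<alpha>_doubly])
    fix d assume d: "d \<in> digits M" "val q d = val q (snth (quasi_greedy M q 1))" "doubly d"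
    have "of_seq d \<in> expansions M q 1 \<and> doubly_infinite M (of_seq d)"
      using d val_\<alpha> q by (simp add: mem_expansions_iff doubly_infinite_iff[OF base])
    moreover have "quasi_greedy M q 1 \<in> expansions M q 1 \<and> doubly_infinite M (quasi_greedy M q 1)"
      using \<alpha>_digits val_\<alpha> \<alpha>_doubly q by (simp add: mem_expansions_iff doubly_infinite_iff[OF base])
    ultimately have "of_seq d = quasi_greedy M q 1"
      using assms(1) by (auto simp: doubly_unique_bases_def)
    then show "d = snth (quasi_greedy M q 1)" by (metis snth_of_seq)
  qed
qed

text \<open>After the first digit, the tail of \<open>\<alpha>\<close> and its reflection both have
  value at most 1, and these values add up to \<open>M / (q - 1)\<close>.\<close>

lemma doubly_unique_base_ge:
  assumes "q \<in> doubly_unique_bases M"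
  shows "real M / 2 + 1 \<le> q"
proof (cases "q = real M + 1")
  case False
  interpret quasi_greedy_base M q "snth (quasi_greedy M q 1)"
    by (rule doubly_unique_base[OF assms False])
  let ?\<alpha> = "snth (quasi_greedy M q 1)"
  have V: "?\<alpha> \<in> V_seqs" by (rule doubly_unique_base[OF assms False])
  have "val q (tail 1 ?\<alpha>) \<le> 1"
  proof (cases "?\<alpha> 0 < M")
    case True
    then show ?thesis using \<alpha>_quasi by (auto simp: quasi_def dest: spec[of _ 0])
  next
    case False
    \<comment> \<open>In this case the tail has value \<open>q - M\<close>, which is below
      1.\<close>
    then have "?\<alpha> 0 = M" using digits_le[OF \<alpha>_digits, of 0] by simp
    then show ?thesis using val_split[OF \<alpha>_digits q_gt_1, of 1] val_\<alpha> q_gt_1 q_less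
      by (simp add: field_simps)
  qed
  moreover have "mirror M ?\<alpha> 0 < M"
    using \<alpha>_0_pos digits_le[OF \<alpha>_digits, of 0] by (simp add: mirror_apply)
  then have "val q (tail 1 (mirror M ?\<alpha>)) \<le> 1"
    using V_seqs_quasi[OF mirror_V_seqs[OF V]] by (auto simp: quasi_def dest: spec[of _ 0])
  moreover have "val q (tail 1 (mirror M ?\<alpha>)) = real M / (q - 1) - val q (tail 1 ?\<alpha>)"
    using \<alpha>_digits q_gt_1 by (simp add: mirror_tail[symmetric] val_mirror)
  ultimately have "real M / (q - 1) \<le> 2" by linarith
  then show ?thesis using q_gt_1 by (simp add: field_simps)
qed simp

text \<open>With \<open>M = 2 * m\<close>, the constant sequence \<open>m\<close> is its own
  reflection and has value 1 in base \<open>m + 1\<close>; it meets both bounds with equality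
  everywhere, and this base attains the general lower bound.\<close>

lemma q_tilde_even:
  assumes "1 \<le> M" "even M"
  shows "q_tilde M = real M / 2 + 1"
  unfolding q_tilde_def
proof (rule Least_equality)
  obtain m where m: "M = 2 * m" using assms(2) by blast
  let ?q = "real M / 2 + 1"
  interpret quasi_greedy_base M ?q "\<lambda>_. m"
  proof
    show "quasi M ?q (\<lambda>_. m)" using assms m by (simp add: quasi_def digits_def tail_def val_const)
    show "\<not> terminates (\<lambda>_. m)" unfolding terminates_def by (metis gt_ex)
  qed (use assms m in \<open>auto simp: val_const\<close>)
  have V: "(\<lambda>_. m) \<in> V_seqs" unfolding V_seqs_def using m
    by (simp add: digits_def tail_def mirror_def)
  have base: "quasi_greedy_base M ?q (\<lambda>_. m)" by unfold_locales
  have "\<exists>!c. c \<in> expansions M ?q 1 \<and> doubly_infinite M c"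
  proof (rule ex1I[of _ "sconst m"])
    show "sconst m \<in> expansions M ?q 1 \<and> doubly_infinite M (sconst m)"
      using \<alpha>_digits val_\<alpha> \<alpha>_doubly q_gt_1
        by (simp add: mem_expansions_iff doubly_infinite_iff[OF base])
    fix c assume "c \<in> expansions M ?q 1 \<and> doubly_infinite M c"
    then have "snth c = snth (sconst m)"
      using V_seqs_unique[OF V, of "snth c"] val_\<alpha> q_gt_1
      by (simp add: mem_expansions_iff doubly_infinite_iff[OF base])
    then show "c = sconst m" by (simp only: snth_eq_iff)
  qed
  then show "?q \<in> doubly_unique_bases M" using q_gt_1 by (simp add: doubly_unique_bases_def)
qed (rule doubly_unique_base_ge)

lemma ex_self_mirror:
  assumes "1 \<le> M" "q \<in> doubly_unique_bases M - closure (unique_bases M)" "\<alpha> = quasi_greedy M q 1"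
  shows "\<exists>j\<ge>1. sdrop j \<alpha> = reflect M \<alpha>"
proof (rule ccontr)
  assume contra: "\<not> ?thesis"
  have "q \<noteq> real M + 1" using assms top_base_unique closure_subset by blast
  with assms interpret quasi_greedy_base M q "snth \<alpha>" using doubly_unique_base(1) by simp
  have V: "snth \<alpha> \<in> V_seqs" using assms \<open>q \<noteq> real M + 1\<close> doubly_unique_base(2) by simp
  have ne: "mirror M (tail n (snth \<alpha>)) \<noteq> snth \<alpha>" if "0 < n" for n
  proof
    assume "mirror M (tail n (snth \<alpha>)) = snth \<alpha>"
    then have "tail n (snth \<alpha>) = mirror M (snth \<alpha>)" using \<alpha>_digits
      by (metis mirror_mirror tail_digits)
    then have "snth (sdrop n \<alpha>) = snth (reflect M \<alpha>)" by simp
    then have "sdrop n \<alpha> = reflect M \<alpha>" by (simp only: snth_eq_iff)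
    with contra that show False by auto
  qed
  have "\<exists>r\<in>unique_bases M. dist r q < e" if e: "0 < e" for e
  proof -
    obtain r \<beta> where r: "1 < r" "\<bar>r - q\<bar> \<le> e / 2" and \<beta>: "\<beta> \<in> digits M" "val r \<beta> = 1"
      "\<And>d. d \<in> digits M \<Longrightarrow> val r d = 1 \<Longrightarrow> d = \<beta>"
      by (rule ex_unique_base_near[OF V _ half_gt_zero[OF e]]) (rule ne, assumption, blast)
    have "\<exists>!c. c \<in> expansions M r 1"
    proof (rule ex1I[of _ "of_seq \<beta>"])
      show "of_seq \<beta> \<in> expansions M r 1" using r(1) \<beta>(1,2) by (simp add: mem_expansions_iff)
      fix c assume "c \<in> expansions M r 1"
      then have "snth c = \<beta>" using r(1) \<beta>(3) by (simp add: mem_expansions_iff)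
      then show "c = of_seq \<beta>" by (metis of_seq_snth)
    qed
    then show ?thesis using r e by (auto simp: unique_bases_def dist_real_def)
  qed
  then have "q \<in> closure (unique_bases M)" by (simp add: closure_approachable)
  with assms(2) show False by simp
qed

section \<open>The sets U_q and V_q as sets of values\<close>

context quasi_greedy_base
begin

lemma U_eq: "U M q = val q ` U_seqs"
proof (intro set_eqI iffI)
  fix x assume "x \<in> U M q"
  then obtain c where c: "c \<in> expansions M q x" "\<And>d. d \<in> expansions M q x \<Longrightarrow> d = c"
    by (auto simp: U_def)
  have "d = snth c" if "d \<in> digits M" "val q d = val q (snth c)" for d
  proof -
    have "of_seq d \<in> expansions M q x" using that c(1) by (simp add: mem_expansions_iff q_gt_1)
    then show ?thesis using c(2) by (metis snth_of_seq)
  qed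
  then have "snth c \<in> U_seqs" using c(1) by (simp add: U_seqs_iff mem_expansions_iff q_gt_1)
  then show "x \<in> val q ` U_seqs" using c(1) by (auto simp: mem_expansions_iff q_gt_1)
next
  fix x assume "x \<in> val q ` U_seqs"
  then obtain c where c: "c \<in> U_seqs" "x = val q c" by blast
  have dig: "c \<in> digits M" using c(1) by (simp add: U_seqs_def)
  have "x \<in> J M q" using val_nonneg[OF dig q_gt_1] val_le[OF dig q_gt_1] c(2) by (simp add: J_def)
  moreover have "\<exists>!d. d \<in> expansions M q x"
  proof (rule ex1I[of _ "of_seq c"])
    show "of_seq c \<in> expansions M q x" using dig c(2) by (simp add: mem_expansions_iff q_gt_1)
    fix d assume "d \<in> expansions M q x"
    then have "snth d = c" using c U_seqs_iff[OF dig] by (simp add: mem_expansions_iff q_gt_1)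
    then show "d = of_seq c" by (metis of_seq_snth)
  qed
  ultimately show "x \<in> U M q" by (simp add: U_def)
qed

lemma V_eq: "V M q = val q ` V_seqs"
proof (intro set_eqI iffI)
  note dbl = doubly_infinite_iff[OF quasi_greedy_base_axioms]
  have V_iff: "x \<in> V M q \<longleftrightarrow> x \<in> J M q \<and> (\<exists>!c. c \<in> expansions M q x \<and> doubly_infinite M c)" for x
    using q_less by (simp add: V_def)
  {
    fix x assume "x \<in> V M q"
    then obtain c where c: "c \<in> expansions M q x" "doubly_infinite M c"
      "\<And>d. d \<in> expansions M q x \<Longrightarrow> doubly_infinite M d \<Longrightarrow> d = c"
      unfolding V_iff by blast
    have dig: "snth c \<in> digits M" and x: "val q (snth c) = x"
      using c(1) by (simp_all add: mem_expansions_iff q_gt_1)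
    have "snth c \<in> V_seqs"
    proof (rule V_seqs_if_unique[OF dig])
      show "doubly (snth c)" using c(2) by (simp add: dbl)
      fix d assume "d \<in> digits M" "val q d = val q (snth c)" "doubly d"
      then have "of_seq d = c" by (intro c(3)) (simp_all add: dbl mem_expansions_iff q_gt_1 x)
      then show "d = snth c" by (metis snth_of_seq)
    qed
    then show "x \<in> val q ` V_seqs" using x by blast
  }
  fix x assume "x \<in> val q ` V_seqs"
  then obtain c where c: "c \<in> V_seqs" "x = val q c" by blast
  have dig: "c \<in> digits M" using c(1) by (simp add: V_seqs_def)
  have "x \<in> J M q" using val_nonneg[OF dig q_gt_1] val_le[OF dig q_gt_1] c(2) by (simp add: J_def)
  moreover have "\<exists>!d. d \<in> expansions M q x \<and> doubly_infinite M d"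
  proof (rule ex1I[of _ "of_seq c"])
    show "of_seq c \<in> expansions M q x \<and> doubly_infinite M (of_seq c)"
      using dig c V_seqs_doubly by (simp add: mem_expansions_iff q_gt_1 dbl)
    fix d assume "d \<in> expansions M q x \<and> doubly_infinite M d"
    then have "snth d = c" using c V_seqs_unique by (simp add: mem_expansions_iff q_gt_1 dbl)
    then show "d = of_seq c" by (metis of_seq_snth)
  qed
  ultimately show "x \<in> V M q" by (simp add: V_iff)
qed

end

section \<open>Expansions of the points of V_q outside U_q\<close>

context self_mirror_base
begin

lemma V_minus_U_eq: "V M q - U M q = val q ` (V_seqs - U_seqs)"
  unfolding U_eq V_eq
  using inj_on_image_set_diff[OF inj_on_val_V_seqs _ U_seqs_subset_V_seqs, of V_seqs] by auto

text \<open>Raising the digit before a tail \<open>\<alpha>\<close> and ending there gives an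
  expansion larger than \<open>c\<close>. So the greedy expansion is larger than \<open>c\<close>
  too, and by \<open>quasi_less\<close> it ends in zeros.\<close>

lemma greedy_finite:
  assumes "x \<in> V M q - U M q"
  shows "finite_seq (greedy M q x)"
proof -
  obtain c where c: "c \<in> V_seqs - U_seqs" "x = val q c" using assms by (auto simp: V_minus_U_eq)
  have dig: "c \<in> digits M" using c(1) by (simp add: V_seqs_def)
  note g = greedy_greatest[OF q_gt_1 less_imp_le[OF q_less] val_nonneg[OF dig q_gt_1] val_le[OF dig q_gt_1]]
  obtain n where n: "c n < M" "tail (Suc n) c = \<alpha>" using V_minus_U_tail[OF c(1)] .
  let ?d = "graft c n (Suc (c n)) (\<lambda>_. 0)"
  have "of_seq ?d \<in> expansions M q (val q c)"
    using dig n q_gt_1 by (simp add: mem_expansions_iff graft_digits val_graft val_\<alpha>)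
  then have "?d \<sqsubseteq> snth (greedy M q (val q c))"
    using g(2)[of "of_seq ?d"] unfolding lex_le_def by (metis snth_of_seq)
  moreover have "c \<sqsubset> ?d" by (auto simp: less_fun_def graft_def intro!: exI[of _ n])
  ultimately have "c \<sqsubset> snth (greedy M q (val q c))" by (rule lex.less_le_trans[rotated])
  then have "terminates (snth (greedy M q (val q c)))"
    by (rule quasi_less(2)[OF V_seqs_quasi[of c] _ q_gt_1, rotated 2])
      (use c(1) g(1) in \<open>simp_all add: mem_expansions_iff q_gt_1\<close>)
  then show ?thesis by (simp add: finite_seq_iff c(2))
qed

lemma expansions_of_1_eqpoll: "expansions M q 1 \<approx> (UNIV :: nat set)"
proof -
  have "{d \<in> digits M. val q d = 1} \<approx> (UNIV :: nat set)"
    using countable_expansions[OF \<alpha>_V] infinite_expansions_of_1 val_\<alpha>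
    by (intro countably_infinite_eqpoll) auto
  then show ?thesis using expansions_eqpoll[OF q_gt_1] eqpoll_trans by blast
qed

text \<open>Inside \<open>mirror M \<alpha>\<close> the tail after \<open>k\<close> digits is
  \<open>\<alpha>\<close>, of value 1; carrying it into the digit before turns the reflected word
  into the reflection of the block with its last digit lowered, followed by zeros.\<close>

lemma val_mirror_word:
  assumes "\<And>i. i < k - 1 \<Longrightarrow> t i = M - \<alpha> i" "t (k - 1) = M - (\<alpha> (k - 1) - 1)" "\<And>i. k \<le> i \<Longrightarrow> t i = 0"
  shows "val q t = real M / (q - 1) - 1"
proof -
  have le: "\<alpha> (k - 1) \<le> M" using \<alpha>_digits by (rule digits_le)
  have "t = graft (mirror M \<alpha>) (k - 1) (Suc (M - \<alpha> (k - 1))) (\<lambda>_. 0)"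
    using assms \<alpha>_last_pos le k_pos by (auto simp: graft_def mirror_apply fun_eq_iff)
  moreover have "val q (graft (mirror M \<alpha>) (k - 1) (Suc (M - \<alpha> (k - 1))) (\<lambda>_. 0)) = val q (mirror M \<alpha>)"
  proof (rule val_graft)
    show "Suc (M - \<alpha> (k - 1)) \<le> M" using mirror_\<alpha>_last_less by simp
    have "tail (Suc (k - 1)) (mirror M \<alpha>) = \<alpha>"
      using k_pos tail_k \<alpha>_digits by (simp add: mirror_tail[symmetric])
    then show "real (Suc (M - \<alpha> (k - 1))) + val q (\<lambda>_. 0) =
        real (mirror M \<alpha> (k - 1)) + val q (tail (Suc (k - 1)) (mirror M \<alpha>))"
      by (simp only: val_\<alpha>) (simp add: mirror_apply)
  qed (use q_gt_1 in auto)
  ultimately show ?thesis using \<alpha>_digits q_gt_1 val_\<alpha> by (simp add: val_mirror)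
qed

lemma graft_expansion:
  assumes "b \<in> expansions M q x" "snth y \<in> digits M" "a \<le> b !! p"
    and "real a + val q (snth y) = real (b !! p) + val q (tail (Suc p) (snth b))"
  shows "(stake p b @ [a]) @- y \<in> expansions M q x"
proof -
  have b: "snth b \<in> digits M" "val q (snth b) = x" using assms(1)
    by (auto simp: mem_expansions_iff q_gt_1)
  have "a \<le> M" using assms(3) digits_le[OF b(1), of p] by simp
  then show ?thesis
    using graft_digits[OF b(1) assms(2)] val_graft[OF b(1) assms(2) _ q_gt_1 assms(4)] b(2)
    by (simp add: mem_expansions_iff q_gt_1 snth_graft del: shift_append)
qed

end

text \<open>That \<open>f\<close> is one more expansion is expressed by its being different from
  \<open>b\<close>, from all members of \<open>F\<close>, and from \<open>e\<close> whenever the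
  conditions for \<open>e\<close> hold.\<close>

theorem theorem1p3:
  fixes M k :: nat and q :: real and \<alpha> :: "nat stream"
  assumes "1 \<le> M"
    and "q \<in> doubly_unique_bases M - closure (unique_bases M)"
    and "\<alpha> = quasi_greedy M q 1"
    and "k = (LEAST j. 1 \<le> j \<and> sdrop j \<alpha> = reflect M \<alpha>)"
  shows "(\<exists>j\<ge>1. sdrop j \<alpha> = reflect M \<alpha>) \<and>
         (closed (U M q) \<and> closed (V M q)) \<and>
         (V M q - U M q \<approx> (UNIV :: nat set) \<and> discrete (V M q - U M q) \<and>
           V M q \<subseteq> closure (V M q - U M q)) \<and>
         (\<forall>x \<in> V M q - U M q.
             expansions M q x \<approx> (UNIV :: nat set) \<and> finite_seq (greedy M q x)) \<and>
         (\<forall>x \<in> V M q - U M q. \<forall>b n.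
             b = greedy M q x \<and> last_nonzero_at b n \<longrightarrow>
             (let F = {decr_last (stake n b) @- d | d. d \<in> expansions M q 1};
                  e = (stake (n - 1) b @ [b !! (n - 1) - 2]) @- sconst M;
                  f = decr_last (stake (n - k) b) @- sconst M
              in F \<subseteq> expansions M q x - {b} \<and> F \<approx> (UNIV :: nat set) \<and>
                 (q = q_tilde M \<and> even M \<and> 2 \<le> b !! (n - 1) \<longrightarrow> e \<in> expansions M q x) \<and>
                 (k < n \<and> 0 < b !! (n - k - 1) \<and>
                  drop (n - k) (stake n b) = reflect_word M (decr_last (stake k \<alpha>)) \<longrightarrow>
                    f \<in> expansions M q x \<and> f \<noteq> b \<and> f \<notin> F \<and>
                    (q = q_tilde M \<and> even M \<and> 2 \<le> b !! (n - 1) \<longrightarrow> f \<noteq> e))))"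
proof -
  have ex: "\<exists>j\<ge>1. sdrop j \<alpha> = reflect M \<alpha>" by (rule ex_self_mirror[OF assms(1-3)])
  have k: "1 \<le> k" "sdrop k \<alpha> = reflect M \<alpha>"
    using LeastI_ex[of "\<lambda>j. 1 \<le> j \<and> sdrop j \<alpha> = reflect M \<alpha>"] ex unfolding assms(4) by blast+
  have "q \<noteq> real M + 1" using assms top_base_unique closure_subset by blast
  with assms interpret quasi_greedy_base M q "snth \<alpha>" using doubly_unique_base(1) by simp
  interpret self_mirror_base M q "snth \<alpha>" k
  proof
    show "snth \<alpha> \<in> V_seqs" using assms \<open>q \<noteq> real M + 1\<close> doubly_unique_base(2) by simp
    show "tail k (snth \<alpha>) = mirror M (snth \<alpha>)" using k(2) by (metis snth_sdrop snth_reflect)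
  qed (use k(1) in simp)
  let ?F = "\<lambda>b n. {decr_last (stake n b) @- d | d. d \<in> expansions M q 1}"
  have greedy_mem: "greedy M q x \<in> expansions M q x" if "x \<in> V M q" for x
    using that greedy_greatest(1)[OF q_gt_1 less_imp_le[OF q_less]] q_less
      by (auto simp: V_def J_def)
  \<comment> \<open>Lowering the last nonzero digit by \<open>j\<close> must be made up by a tail of
    value \<open>j\<close>. The choice \<open>j = 1\<close> produces \<open>F\<close>;
    \<open>j = 2\<close> produces \<open>e\<close>, because M^inf has value 2 in base
    \<open>M / 2 + 1\<close>.\<close>
  have lower: "(stake p b @ [b !! p - j]) @- y \<in> expansions M q x"
    if "b \<in> expansions M q x" "\<forall>i>p. b !! i = 0" "snth y \<in> digits M" "val q (snth y) = real j" "j \<le> b !! p"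
    for b x p y j
  proof (rule graft_expansion[OF that(1,3)])
    have "tail (Suc p) (snth b) = (\<lambda>_. 0)"
      using that(2) by (intro ext) (simp add: tail_apply del: snth.simps)
    then show "real (b !! p - j) + val q (snth y) = real (b !! p) + val q (tail (Suc p) (snth b))"
      using that(4,5) by (simp add: of_nat_diff)
  qed simp
  have F: "?F b n \<subseteq> expansions M q x - {b}" "?F b n \<approx> (UNIV :: nat set)"
    if b: "b \<in> expansions M q x" "last_nonzero_at b n" for b n x
  proof -
    obtain p where p: "n = Suc p" "b !! p \<noteq> 0" "\<forall>i>p. b !! i = 0" using last_nonzero_atE[OF b(2)] .
    have "decr_last (stake n b) @- d \<in> expansions M q x" if "d \<in> expansions M q 1" for d
      using lower[OF b(1) p(3), of d 1] that p(2) q_gt_1 unfolding p(1) decr_last_stake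
      by (simp add: mem_expansions_iff del: shift_append)
    moreover have "decr_last (stake n b) @- d \<noteq> b" for d
    proof
      assume "decr_last (stake n b) @- d = b"
      then have "snth (decr_last (stake n b) @- d) p = b !! p" by simp
      then show False using p(2) unfolding p(1) decr_last_stake snth_graft by (simp add: graft_def)
    qed
    ultimately show "?F b n \<subseteq> expansions M q x - {b}" by auto
    have "?F b n = (\<lambda>d. decr_last (stake n b) @- d) ` expansions M q 1" by auto
    also have "\<dots> \<approx> expansions M q 1" by (intro inj_on_image_eqpoll_self inj_onI) simp
    also have "\<dots> \<approx> (UNIV :: nat set)" by (rule expansions_of_1_eqpoll)
    finally show "?F b n \<approx> (UNIV :: nat set)" .
  qed
  have expansions_inf: "expansions M q x \<approx> (UNIV :: nat set)" if x: "x \<in> V M q - U M q" for x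
  proof -
    obtain c where c: "c \<in> V_seqs" "x = val q c" using x by (auto simp: V_minus_U_eq)
    obtain n where "last_nonzero_at (greedy M q x) n" using greedy_finite[OF x]
      by (auto simp: finite_seq_def)
    moreover have "greedy M q x \<in> expansions M q x" using greedy_mem x by simp
    ultimately have F: "?F (greedy M q x) n \<subseteq> expansions M q x - {greedy M q x}"
      "?F (greedy M q x) n \<approx> (UNIV :: nat set)" using F by simp_all
    have "infinite (?F (greedy M q x) n)" using eqpoll_finite_iff[OF F(2)] by simp
    then have "infinite (expansions M q x)" using F(1) finite_subset[of _ "expansions M q x"]
      by blast
    moreover have "countable (expansions M q x)"
      using countable_expansions[OF c(1)] expansions_eqpoll[OF q_gt_1] countable_eqpoll c(2)
        by blast
    ultimately show ?thesis by (intro countably_infinite_eqpoll)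
  qed
  have e: "(stake (n - 1) b @ [b !! (n - 1) - 2]) @- sconst M \<in> expansions M q x"
    if b: "b \<in> expansions M q x" "last_nonzero_at b n"
      and q: "q = q_tilde M" "even M" "2 \<le> b !! (n - 1)" for b n x
  proof -
    obtain p where p: "n = Suc p" "\<forall>i>p. b !! i = 0" using last_nonzero_atE[OF b(2)] .
    have "q = real M / 2 + 1" using q q_tilde_even assms(1) by simp
    then have "val q (snth (sconst M)) = real 2" using q_gt_1 by (simp add: val_const)
    then show ?thesis using lower[OF b(1) p(2), of "sconst M" 2] q(3)
      by (simp add: p(1) digits_def del: shift_append)
  qed
  have f: "decr_last (stake (n - k) b) @- sconst M \<in> expansions M q x"
      "decr_last (stake (n - k) b) @- sconst M \<noteq> b"
      "decr_last (stake (n - k) b) @- sconst M \<notin> ?F b n"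
      "decr_last (stake (n - k) b) @- sconst M \<noteq> (stake (n - 1) b @ [b !! (n - 1) - 2]) @- sconst M"
    if b: "b \<in> expansions M q x" "last_nonzero_at b n" and n: "k < n" "0 < b !! (n - k - 1)"
      "drop (n - k) (stake n b) = reflect_word M (decr_last (stake k \<alpha>))" for b n x
  proof -
    obtain p where p: "n = Suc p" "\<forall>i>p. b !! i = 0" using last_nonzero_atE[OF b(2)] .
    define r where "r = n - k - 1"
    have r: "n - k = Suc r" "r < p" "Suc r + (k - 1) = p" using n(1) k(1) p(1) by (auto simp: r_def)
    obtain k' where k': "k = Suc k'" using k(1) by (cases k) auto
    have words: "stake k (sdrop (Suc r) b) = map (\<lambda>d. M - d) (stake k' \<alpha> @ [\<alpha> !! k' - 1])"
      using n(3) n(1) unfolding drop_stake reflect_word_def r(1)[symmetric] k' decr_last_stake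
        by simp
    have digit: "b !! (Suc r + i) = M - (if i < k' then \<alpha> !! i else \<alpha> !! k' - 1)" if "i < k" for i
    proof -
      have "b !! (Suc r + i) = stake k (sdrop (Suc r) b) ! i"
        using that by (simp only: stake_nth sdrop_snth)
      also have "\<dots> = M - (if i < k' then \<alpha> !! i else \<alpha> !! k' - 1)"
        using that unfolding words by (auto simp: k' nth_append less_Suc_eq)
      finally show ?thesis .
    qed
    \<comment> \<open>This falls short of the value of M^inf by exactly 1, which is what lowering
      the digit at \<open>r\<close> provides.\<close>
    have "val q (tail (Suc r) (snth b)) = real M / (q - 1) - 1"
    proof (rule val_mirror_word)
      show "tail (Suc r) (snth b) i = M - snth \<alpha> i" if "i < k - 1" for i
        using digit[of i] that k' by (simp add: tail_apply)
      show "tail (Suc r) (snth b) (k - 1) = M - (snth \<alpha> (k - 1) - 1)"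
        using digit[of k'] k' by (simp add: tail_apply)
      show "tail (Suc r) (snth b) i = 0" if "k \<le> i" for i
        using p(2) r(3) that k(1) by (simp add: tail_apply del: snth.simps)
    qed
    then show "decr_last (stake (n - k) b) @- sconst M \<in> expansions M q x"
      unfolding r(1) decr_last_stake
      using n(2) q_gt_1 r_def
        by (intro graft_expansion[OF b(1)]) (auto simp: digits_def val_const of_nat_diff)
    have f_r: "snth (decr_last (stake (n - k) b) @- sconst M) r = b !! r - 1"
      unfolding r(1) decr_last_stake snth_graft by (simp add: graft_def)
    have r_pos: "0 < b !! r" using n(2) by (simp add: r_def)
    show "decr_last (stake (n - k) b) @- sconst M \<noteq> b" using f_r r_pos by auto
    \<comment> \<open>\<open>f\<close> differs from \<open>b\<close> already at \<open>r\<close>,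
      whereas \<open>e\<close> and the members of \<open>F\<close> agree with \<open>b\<close>
      before position \<open>p\<close>.\<close>
    have other: "snth ((stake p b @ [a]) @- y) r = b !! r" for a y
      unfolding snth_graft using r(2) by (simp add: graft_def)
    have neq: "decr_last (stake (n - k) b) @- sconst M \<noteq> (stake p b @ [a]) @- y" for a y
      using f_r other[of a y] r_pos by (metis diff_less less_irrefl_nat zero_less_one)
    show "decr_last (stake (n - k) b) @- sconst M \<notin> ?F b n"
      using neq unfolding p(1) decr_last_stake by blast
    show "decr_last (stake (n - k) b) @- sconst M \<noteq> (stake (n - 1) b @ [b !! (n - 1) - 2]) @- sconst M"
      using neq unfolding p(1) by simp
  qed
  have "closed (U M q)" unfolding U_eq
    by (rule closed_val_image[OF q_gt_1 closed_U_seqs]) (auto simp: U_seqs_def)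
  moreover have "closed (V M q)" unfolding V_eq
    by (rule closed_val_image[OF q_gt_1 closed_V_seqs]) (auto simp: V_seqs_def)
  moreover have "V M q - U M q \<approx> (UNIV :: nat set)"
  proof -
    have "inj_on (val q) (V_seqs - U_seqs)" using inj_on_val_V_seqs by (rule inj_on_diff)
    then have "infinite (V M q - U M q)" using infinite_V_minus_U finite_imageD
      unfolding V_minus_U_eq by blast
    moreover have "countable (V M q - U M q)" unfolding V_minus_U_eq using countable_V_minus_U
      by simp
    ultimately show ?thesis by (intro countably_infinite_eqpoll)
  qed
  moreover have "discrete (V M q - U M q)" unfolding V_minus_U_eq by (rule discrete_values)
  moreover have "V M q \<subseteq> closure (V M q - U M q)"
    using dense_values by (simp only: V_minus_U_eq[symmetric] V_eq[symmetric])
  ultimately show ?thesis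
    using ex expansions_inf greedy_finite F[OF greedy_mem] e[OF greedy_mem] f[OF greedy_mem]
    unfolding Let_def by auto
qed

end
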